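(* Let $a,b,c\in\mathbb{R}$ with $a\le 1$, $c>b>0$ and $c>b-a$. Let $w$, $p_0$, $p_E$, $H_a$ and $A_p$ be as defined in the context. (1) Suppose $c\ge\max(1-2a,2b)$. Then $0<p_0\le p_E\le 1$, and for arbitrary $\lambda,\mu\in\mathbb{R}$, $$A_\lambda(w;1,1-r)\le H_a(r)\le A_\mu(w;1,1-r)\quad\text{for all } r\in(0,1)$$ holds if and only if $\lambda\le p_0$ and $\mu\ge p_E$. If $a=1$, then $p_0=p_E=1$ and $H_1(r)=A_1(w;1,1-r)$ for every $r\in(0,1)$. If $c=2b=1-2a$, then $p_0=p_E=\frac12$ and $H_a(r)=A_{1/2}(w;1,1-r)$ for every $r\in(0,1)$. Outside these two cases, one has $p_0<p_E<1$ and $$A_{p_0}(w;1,1-r)<H_a(r)<A_{p_E}(w;1,1-r)\quad\text{for all } r\in(0,1).$$ (2) Suppose $c\le\min(1-2a,2b)$. Then $0<p_E\le p_0<1$, and for arbitrary $\lambda,\mu\in\mathbb{R}$, $$A_\lambda(w;1,1-r)\le H_a(r)\le A_\mu(w;1,1-r)\quad\text{for all } r\in(0,1)$$ holds if and only if $\lambda\le p_E$ and $\mu\ge p_0$. The equality case is again exactly $c=2b=1-2a$: one has $p_E=p_0$ if and only if $c=2b=1-2a$, and in that case $p_0=p_E=\frac12$ and $H_a(r)=A_{1/2}(w;1,1-r)$ for every $r\in(0,1)$. Outside this case, $$A_{p_E}(w;1,1-r)<H_a(r)<A_{p_0}(w;1,1-r)\quad\text{for all } r\in(0,1).$$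
   Context: Weighted power means: for $0<w<1$, $h>0$, $p\in\mathbb{R}$, $A_p(w;1,h)=[w+(1-w)h^p]^{1/p}$ if $p\ne0$ and $A_0(w;1,h)=h^{1-w}$. For $c>b>0$ and $0<r<1$: if $a\neq0$, $H_a(r)={}_2F_1(-a,b;c;r)^{1/a}$, where ${}_2F_1$ is the Gauss hypergeometric function (here ${}_2F_1(-a,b;c;r)>0$); if $a=0$, $$H_0(r)=\exp\left(\frac{1}{B(b,c-b)}\int_0^1 t^{b-1}(1-t)^{c-b-1}\log(1-rt)\,dt\right),$$ where $B$ is the Euler beta function. Parameters (with $c+a-b>0$): $w=1-\frac bc$, $p_0=\frac{a+c}{1+c}$, $C_a=\frac{\Gamma(c+a-b)\Gamma(c)}{\Gamma(c-b)\Gamma(c+a)}$. If $a\ne0$, $p_E=\frac{a\log w}{\log C_a}$. If $a=0$, $p_E=\frac{\log w}{L_0}$ with $L_0=\frac{1}{B(b,c-b)}\int_0^1t^{b-1}(1-t)^{c-b-1}\log(1-t)\,dt<0$. *)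

theory Defs
  imports "HOL-Analysis.Analysis"
begin

definition power_mean :: "real \<Rightarrow> real \<Rightarrow> real \<Rightarrow> real" where
  "power_mean p w h =
     (if p = 0 then h powr (1 - w) else (w + (1 - w) * h powr p) powr (1 / p))"

text \<open>
  The Gauss hypergeometric function as the sum of its power series
  \<open>\<Sum>n. (\<alpha>)\<^sub>n (\<beta>)\<^sub>n / ((\<gamma>)\<^sub>n n!) * x ^ n\<close>; it is only used for \<open>\<bar>x\<bar> < 1\<close> and \<open>\<gamma> > 0\<close>.
\<close>
definition hyp2F1 :: "real \<Rightarrow> real \<Rightarrow> real \<Rightarrow> real \<Rightarrow> real" where
  "hyp2F1 \<alpha> \<beta> \<gamma> x = eval_fps (fps_hypergeo [\<alpha>, \<beta>] [\<gamma>] 1) x"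

text \<open>
  The mean of \<open>ln (1 - r * t)\<close> under the Beta density with parameters \<open>b\<close> and \<open>c - b\<close>.
  For \<open>r = 1\<close> the integrand is unbounded at \<open>t = 1\<close>, but the integral is still absolutely
  convergent when \<open>c > b > 0\<close>; the value given to the integrand at the endpoints is irrelevant.
\<close>
definition beta_log_mean :: "real \<Rightarrow> real \<Rightarrow> real \<Rightarrow> real" where
  "beta_log_mean b c r =
     1 / Beta b (c - b) *
     integral {0..1} (\<lambda>t. t powr (b - 1) * (1 - t) powr (c - b - 1) * ln (1 - r * t))"

text \<open>
  When \<open>c > b > 0\<close> and \<open>0 < r < 1\<close>, the value of the hypergeometric function below is positive, so
  \<open>powr\<close> is the usual real power.
\<close>
definition hyp_mean :: "real \<Rightarrow> real \<Rightarrow> real \<Rightarrow> real \<Rightarrow> real" where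
  "hyp_mean a b c r =
     (if a = 0 then exp (beta_log_mean b c r) else hyp2F1 (- a) b c r powr (1 / a))"

definition mean_weight :: "real \<Rightarrow> real \<Rightarrow> real" where
  "mean_weight b c = 1 - b / c"

definition p_zero :: "real \<Rightarrow> real \<Rightarrow> real" where
  "p_zero a c = (a + c) / (1 + c)"

definition gauss_const :: "real \<Rightarrow> real \<Rightarrow> real \<Rightarrow> real" where
  "gauss_const a b c = Gamma (c + a - b) * Gamma c / (Gamma (c - b) * Gamma (c + a))"

text \<open>
  The exponent at which the power mean and \<open>hyp_mean\<close> have the same limit as \<open>r\<close> tends to 1.
  When \<open>c > b > 0\<close> and \<open>c + a > b\<close>, both denominators are nonzero: \<open>beta_log_mean b c 1 < 0\<close>, and
  \<open>gauss_const a b c\<close> differs from 1 for \<open>a \<noteq> 0\<close>.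
\<close>
definition p_end :: "real \<Rightarrow> real \<Rightarrow> real \<Rightarrow> real" where
  "p_end a b c =
     (if a = 0 then ln (mean_weight b c) / beta_log_mean b c 1
      else a * ln (mean_weight b c) / ln (gauss_const a b c))"

end

theory Submission
  imports Defs
begin

text \<open>
  Let \<open>H\<close> be the hypergeometric mean and \<open>A\<close> the power mean of exponent \<open>p\<close>.
  Write \<open>u\<close> and \<open>v\<close> for the logarithmic derivatives of \<open>H\<close> and \<open>A\<close> in \<open>r\<close>. The
  hypergeometric equation turns into a Riccati equation for \<open>u\<close> that makes sense for \<open>a = 0\<close>
  as well. Inserting \<open>v\<close> into it leaves a positive multiple of an explicit combination of powers
  of \<open>1 - r\<close> that vanishes at \<open>r = 0\<close>, has slope \<open>p (1 + c) - (a + c)\<close> there, and is convex or concave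
  on the whole interval under the assumptions on the parameters. So it has constant sign for \<open>p = p_zero\<close>
  and at most one sign change for the other relevant \<open>p\<close>. With an integrating factor this sign pattern passes on to
  \<open>u - v\<close>, and then to \<open>ln H - ln A\<close>, which vanishes at \<open>r = 0\<close> and, exactly for \<open>p = p_end\<close>, also in
  the limit \<open>r \<rightarrow> 1\<close>. Comparison with \<open>p = 1\<close> gives \<open>p_end \<le> 1\<close>.
\<close>

subsection \<open>Sign patterns of a function and its derivative\<close>

text \<open>Only a limit at 0 is assumed, so \<open>g\<close> need not be differentiable there.
  Decrease bounds \<open>g (r/2)\<close> by values nearer to 0, hence by the limit 0; the step from
  \<open>r/2\<close> to \<open>r\<close> makes the inequality strict.\<close>

lemma neg_of_deriv_neg:
  fixes g g' :: "real \<Rightarrow> real"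
  assumes lim: "(g \<longlongrightarrow> 0) (at_right 0)"
    and der: "\<And>r. 0 < r \<Longrightarrow> r < y \<Longrightarrow> (g has_real_derivative g' r) (at r)"
    and neg: "\<And>r. 0 < r \<Longrightarrow> r < y \<Longrightarrow> g' r < 0"
    and r: "0 < r" "r < y"
  shows "g r < 0"
proof -
  have dec: "g t < g s" if "0 < s" "s < t" "t < y" for s t
  proof (rule DERIV_neg_imp_decreasing[OF \<open>s < t\<close>])
    fix x assume "s \<le> x" "x \<le> t"
    then show "\<exists>d. (g has_real_derivative d) (at x) \<and> d < 0"
      using that der[of x] neg[of x] by (intro exI[of _ "g' x"]) auto
  qed
  have "\<forall>\<^sub>F t in at_right 0. g (r/2) \<le> g t"
    unfolding eventually_at_right_field using r dec by (intro exI[of _ "r/2"]) (auto intro: less_imp_le)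
  then have "g (r/2) \<le> 0"
    by (intro tendsto_lowerbound[OF lim]) auto
  with dec[of "r/2" r] r show ?thesis by auto
qed

lemma eventually_neg_of_deriv_neg:
  fixes g g' :: "real \<Rightarrow> real"
  assumes lim: "(g \<longlongrightarrow> 0) (at_right 0)"
    and der: "\<And>r. 0 < r \<Longrightarrow> r < 1 \<Longrightarrow> (g has_real_derivative g' r) (at r)"
    and neg: "\<forall>\<^sub>F r in at_right 0. g' r < 0"
  shows "\<forall>\<^sub>F r in at_right 0. g r < 0"
proof -
  obtain y where y: "y > 0" "\<And>r. 0 < r \<Longrightarrow> r < y \<Longrightarrow> g' r < 0"
    using neg unfolding eventually_at_right_field by auto
  have "g r < 0" if "0 < r" "r < min y 1" for r
    by (rule neg_of_deriv_neg[OF lim, of "min y 1" g']) (use der y that in auto)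
  then show ?thesis
    unfolding eventually_at_right_field using y(1) by (intro exI[of _ "min y 1"]) auto
qed

text \<open>The pattern means at most one sign change and includes functions that stay negative. It
  survives positive factors and integration from 0, the two operations that lead from the defect to
  the difference of the logarithms of the means.\<close>

definition neg_then_pos :: "(real \<Rightarrow> real) \<Rightarrow> bool" where
  "neg_then_pos g \<longleftrightarrow> (\<forall>\<^sub>F r in at_right 0. g r < 0) \<and>
     (\<forall>r s. 0 < r \<longrightarrow> r < s \<longrightarrow> s < 1 \<longrightarrow> 0 \<le> g r \<longrightarrow> 0 < g s)"

lemma neg_then_pos_cong:
  assumes "neg_then_pos g" and "\<And>r. 0 < r \<Longrightarrow> r < 1 \<Longrightarrow> \<exists>m>0. f r = m * g r"
  shows "neg_then_pos f"
proof -
  have sgn: "(f r < 0 \<longleftrightarrow> g r < 0) \<and> (0 < f r \<longleftrightarrow> 0 < g r)" if "0 < r" "r < 1" for r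
    using assms(2)[OF that] by (auto simp: mult_less_0_iff zero_less_mult_iff)
  have "\<forall>\<^sub>F r in at_right 0. (0::real) < r \<and> r < 1"
    unfolding eventually_at_right_field by (intro exI[of _ 1]) auto
  moreover have "\<forall>\<^sub>F r in at_right 0. g r < 0"
    using assms(1) unfolding neg_then_pos_def by blast
  ultimately have "\<forall>\<^sub>F r in at_right 0. f r < 0"
    by eventually_elim (use sgn in auto)
  moreover have "0 < f s" if "0 < r" "r < s" "s < 1" "0 \<le> f r" for r s
    using assms(1) sgn[of r] sgn[of s] that unfolding neg_then_pos_def by (meson less_trans not_less)
  ultimately show ?thesis unfolding neg_then_pos_def by blast
qed

text \<open>If \<open>g'\<close> were negative on all of (0, r), then \<open>g r\<close> would be
  negative. So \<open>g'\<close> is nonnegative somewhere before \<open>r\<close> and positive from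
  there on.\<close>

lemma neg_then_pos_increasing:
  assumes lim: "(g \<longlongrightarrow> 0) (at_right 0)"
    and der: "\<And>r. 0 < r \<Longrightarrow> r < 1 \<Longrightarrow> (g has_real_derivative g' r) (at r)"
    and sc: "neg_then_pos g'"
    and rs: "0 < r" "r < s" "s < 1" "0 \<le> g r"
  shows "g r < g s"
proof -
  have "\<exists>x. 0 < x \<and> x < r \<and> 0 \<le> g' x"
  proof (rule ccontr)
    assume "\<not> ?thesis"
    then have neg: "g' x < 0" if "0 < x" "x < r" for x using that by force
    have neg2: "g x < 0" if "0 < x" "x < r" for x
      by (rule neg_of_deriv_neg[OF lim, of r g']) (use der neg that rs in auto)
    have "g r < g (r/2)"
    \<comment> \<open>The sign of \<open>g'\<close> is known only before \<open>r\<close>;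
      continuity carries the decrease up to \<open>r\<close> itself.\<close>
    proof (rule DERIV_neg_imp_decreasing_open[of "r/2" r g])
      show "\<And>x. r / 2 < x \<Longrightarrow> x < r \<Longrightarrow> \<exists>y. (g has_real_derivative y) (at x) \<and> y < 0"
        using der neg rs by (meson half_gt_zero less_trans)
      show "continuous_on {r/2..r} g"
        using rs by (intro continuous_at_imp_continuous_on ballI DERIV_isCont[OF der]) auto
    qed (use rs in auto)
    with neg2[of "r/2"] rs show False by auto
  qed
  then obtain x where x: "0 < x" "x < r" "0 \<le> g' x" by blast
  have pos: "0 < g' t" if "x < t" "t < 1" for t
    using sc x that unfolding neg_then_pos_def by blast
  show ?thesis
  proof (rule DERIV_pos_imp_increasing[OF rs(2)])
    fix t assume "r \<le> t" "t \<le> s"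
    then show "\<exists>y. (g has_real_derivative y) (at t) \<and> 0 < y"
      using der[of t] pos[of t] x rs by (intro exI[of _ "g' t"]) auto
  qed
qed

lemma neg_then_pos_of_deriv:
  assumes lim: "(g \<longlongrightarrow> 0) (at_right 0)"
    and der: "\<And>r. 0 < r \<Longrightarrow> r < 1 \<Longrightarrow> (g has_real_derivative g' r) (at r)"
    and sc: "neg_then_pos g'"
  shows "neg_then_pos g"
  using eventually_neg_of_deriv_neg[OF lim der] neg_then_pos_increasing[OF lim der sc] sc
  unfolding neg_then_pos_def by force

text \<open>Once nonnegative, \<open>g\<close> would increase from then on and could not return to 0
  at 1.\<close>

lemma neg_of_neg_then_pos_deriv:
  assumes lim: "(g \<longlongrightarrow> 0) (at_right 0)" "(g \<longlongrightarrow> 0) (at_left 1)"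
    and der: "\<And>r. 0 < r \<Longrightarrow> r < 1 \<Longrightarrow> (g has_real_derivative g' r) (at r)"
    and sc: "neg_then_pos g'"
    and r: "0 < r" "r < 1"
  shows "g r < 0"
proof (rule ccontr)
  assume "\<not> g r < 0"
  then have nonneg: "0 \<le> g r" by simp
  \<comment> \<open>Since \<open>g r\<close> may be 0, a later point is taken, where the value is
    strictly positive and bounds the limit from below.\<close>
  define q where "q = (r + 1) / 2"
  have q: "r < q" "q < 1" using r by (auto simp: q_def)
  have gq: "0 < g q"
    using neg_then_pos_increasing[OF lim(1) der sc r(1) q nonneg] nonneg by simp
  have "\<forall>\<^sub>F t in at_left 1. g q \<le> g t"
    unfolding eventually_at_left_field
    using q r gq by (intro exI[of _ q] conjI allI impI less_imp_le
      neg_then_pos_increasing[OF lim(1) der sc]) auto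
  then have "g q \<le> 0"
    by (intro tendsto_lowerbound[OF lim(2)]) auto
  with gq show False by simp
qed

lemma neg_limit_of_deriv_neg:
  fixes g g' :: "real \<Rightarrow> real"
  assumes lim: "(g \<longlongrightarrow> 0) (at_right 0)" "(g \<longlongrightarrow> L) (at_left 1)"
    and der: "\<And>r. 0 < r \<Longrightarrow> r < 1 \<Longrightarrow> (g has_real_derivative g' r) (at r)"
    and neg: "\<And>r. 0 < r \<Longrightarrow> r < 1 \<Longrightarrow> g' r < 0"
  shows "L < 0"
proof -
  have "g (1/2) < 0"
    by (rule neg_of_deriv_neg[OF lim(1), of 1 g']) (use der neg in auto)
  moreover have "g t < g (1/2)" if "1/2 < t" "t < 1" for t
  proof (rule DERIV_neg_imp_decreasing[OF \<open>1/2 < t\<close>])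
    fix x :: real assume "1/2 \<le> x" "x \<le> t"
    then show "\<exists>d. (g has_real_derivative d) (at x) \<and> d < 0"
      using that der[of x] neg[of x] by (intro exI[of _ "g' x"]) auto
  qed
  then have "\<forall>\<^sub>F t in at_left 1. g t \<le> g (1/2)"
    unfolding eventually_at_left_field by (intro exI[of _ "1/2"]) (auto intro: less_imp_le)
  then have "L \<le> g (1/2)"
    by (intro tendsto_upperbound[OF lim(2)]) auto
  ultimately show ?thesis by simp
qed

lemma zero_of_deriv_zero:
  fixes g :: "real \<Rightarrow> real"
  assumes lim: "(g \<longlongrightarrow> 0) (at_right 0)"
    and der: "\<And>r. 0 < r \<Longrightarrow> r < 1 \<Longrightarrow> (g has_real_derivative 0) (at r)"
    and r: "0 < r" "r < 1"
  shows "g r = 0"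
proof -
  have "\<exists>k. \<forall>x\<in>{0<..<1}. g x = k"
    by (intro has_field_derivative_zero_constant)
      (auto intro: has_field_derivative_at_within der)
  then obtain k where k: "\<And>x. x \<in> {0<..<1} \<Longrightarrow> g x = k" by blast
  have "\<forall>\<^sub>F x in at_right 0. g x = k"
    unfolding eventually_at_right_field by (intro exI[of _ 1]) (use k in auto)
  then have "(g \<longlongrightarrow> k) (at_right 0)"
    by (rule tendsto_eventually)
  then have "k = 0"
    using lim tendsto_unique trivial_limit_at_right_real by blast
  with k r show ?thesis by auto
qed

lemma isCont_imp_tendsto_at_right:
  "isCont f (x :: real) \<Longrightarrow> (f \<longlongrightarrow> f x) (at_right x)"
  unfolding isCont_def by (rule tendsto_within_subset) auto

subsection \<open>Power means\<close>

text \<open>The geometric mean lies below the means of positive exponent and above those of negative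
  exponent, by AM-GM for 1 and \<open>h powr t\<close>. Two positive exponents are compared by
  convexity of the power \<open>q / p\<close>. The case \<open>0 < q\<close> suffices because both
  critical exponents are positive.\<close>

lemma power_mean_mono:
  assumes w: "0 < w" "w < 1" and h: "0 < h" and pq: "p \<le> q" "0 < q"
  shows "power_mean p w h \<le> power_mean q w h"
proof -
  have amgm: "(h powr t) powr (1 - w) \<le> w + (1 - w) * h powr t" for t
    using Youngs_inequality_0[of w "1 - w" 1 "h powr t"] w h by auto
  have geometric_le: "h powr (1 - w) \<le> power_mean t w h" if "0 < t" for t
  proof -
    have "((h powr t) powr (1 - w)) powr (1 / t) \<le> (w + (1 - w) * h powr t) powr (1 / t)"
      using amgm that by (intro powr_mono2) auto
    then show ?thesis using that by (simp add: power_mean_def powr_powr)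
  qed
  have le_geometric: "power_mean t w h \<le> h powr (1 - w)" if "t < 0" for t
  proof -
    have "(w + (1 - w) * h powr t) powr (1 / t) \<le> ((h powr t) powr (1 - w)) powr (1 / t)"
      using amgm that h by (intro powr_mono2') auto
    then show ?thesis using that by (simp add: power_mean_def powr_powr)
  qed
  show ?thesis
  proof (cases "0 < p")
    case True
    have "((1 - (1 - w)) *\<^sub>R 1 + (1 - w) *\<^sub>R h powr p) powr (q / p)
          \<le> (1 - (1 - w)) * 1 powr (q / p) + (1 - w) * (h powr p) powr (q / p)"
      using convex_onD[OF powr_convex[of "q / p"], of "1 - w" 1 "h powr p"] True pq w h by auto
    then have "(w + (1 - w) * h powr p) powr (q / p) \<le> w + (1 - w) * h powr q"
      using True by (simp add: powr_powr)
    then have "((w + (1 - w) * h powr p) powr (q / p)) powr (1 / q)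
               \<le> (w + (1 - w) * h powr q) powr (1 / q)"
      using pq by (intro powr_mono2) auto
    then show ?thesis using True pq by (simp add: power_mean_def powr_powr)
  next
    case False
    then show ?thesis
      using geometric_le[OF pq(2)] le_geometric[of p]
      by (cases "p = 0") (auto simp: power_mean_def intro: order_trans)
  qed
qed

subsection \<open>The power series of the hypergeometric mean\<close>

text \<open>
  The mean of \<open>box_cox a (1 - r * t)\<close> under the Beta density is \<open>box_cox a (hyp_mean a b c r)\<close> for
  every \<open>a\<close>, which avoids a separate treatment of \<open>a = 0\<close>.
\<close>
definition box_cox :: "real \<Rightarrow> real \<Rightarrow> real" where
  "box_cox a y = (if a = 0 then ln y else (y powr a - 1) / a)"

text \<open>
  The Taylor coefficients of \<open>box_cox a (1 - x)\<close>. The truncated \<open>n - 1\<close> only matters for \<open>n = 0\<close>.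
\<close>
definition box_cox_coeff :: "real \<Rightarrow> nat \<Rightarrow> real" where
  "box_cox_coeff a n = (if n = 0 then 0 else - pochhammer (1 - a) (n - 1) / fact n)"

text \<open>This is the logarithmic series for \<open>a = 0\<close>, and otherwise the binomial
  series without its constant term. There \<open>pochhammer (- a) n\<close> splits off the factor
  \<open>- a\<close>, which cancels the division by \<open>a\<close>.\<close>

lemma box_cox_sums:
  assumes "\<bar>x\<bar> < 1"
  shows "(\<lambda>n. box_cox_coeff a n * x ^ n) sums box_cox a (1 - x)"
proof (cases "a = 0")
  case True
  have "- ((- (- x)) ^ n) / of_nat n = box_cox_coeff a n * x ^ n" for n
    using True by (cases n) (auto simp: box_cox_coeff_def pochhammer_fact[symmetric])
  then show ?thesis
    using ln_series'[of "- x"] assms True by (simp add: box_cox_def)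
next
  case False
  have coeff: "(a gchoose n) * (- x) ^ n - (if n = 0 then 1 else 0) = a * (box_cox_coeff a n * x ^ n)" for n
  proof (cases n)
    case 0
    then show ?thesis by (simp add: box_cox_coeff_def)
  next
    case (Suc m)
    have "(a gchoose n) * (- x) ^ n = pochhammer (- a) n / fact n * (((-1) ^ n) * (- x) ^ n)"
      by (simp add: gbinomial_pochhammer)
    also have "((-1) ^ n) * (- x) ^ n = x ^ n"
      by (simp add: power_mult_distrib[symmetric])
    also have "pochhammer (- a) n = - a * pochhammer (1 - a) m"
      by (simp add: Suc pochhammer_rec)
    finally show ?thesis by (simp add: box_cox_coeff_def Suc)
  qed
  have "(\<lambda>n. (a gchoose n) * (- x) ^ n - (if n = 0 then 1 else 0)) sums ((1 - x) powr a - 1)"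
    using gen_binomial_real[of "- x" a] sums_single[of 0 "\<lambda>_. 1 :: real"] assms
    by (intro sums_diff) auto
  then have "(\<lambda>n. 1 / a * (a * (box_cox_coeff a n * x ^ n))) sums (1 / a * ((1 - x) powr a - 1))"
    unfolding coeff by (rule sums_mult)
  then show ?thesis using False by (simp add: box_cox_def)
qed

lemma box_cox_mono:
  assumes "0 < x" "x \<le> y"
  shows "box_cox a x \<le> box_cox a y"
proof (cases "a > 0")
  case True
  then show ?thesis using assms by (auto simp: box_cox_def intro!: divide_right_mono powr_mono2)
next
  case False
  then show ?thesis using assms
    by (auto simp: box_cox_def intro!: divide_right_mono_neg powr_mono2')
qed

lemma box_cox_1 [simp]: "box_cox a 1 = 0"
  by (simp add: box_cox_def)

text \<open>Take ln z \<le> z - 1 at z = \<open>y powr a\<close> and divide by the negative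
  \<open>a\<close>. This provides an integrable bound for the logarithm near 0.\<close>

lemma ln_ge_box_cox:
  assumes "0 < y" "a < 0"
  shows "box_cox a y \<le> ln y"
proof -
  have "a * ln y \<le> y powr a - 1"
    using ln_le_minus_one[of "y powr a"] assms by (simp add: ln_powr)
  then show ?thesis using assms by (simp add: box_cox_def field_simps)
qed

lemma continuous_on_box_cox: "continuous_on {0<..} (box_cox a)"
  unfolding box_cox_def[abs_def] by (cases "a = 0") (auto intro!: continuous_intros)

text \<open>The quotients \<open>pochhammer b n / pochhammer c n\<close> of the hypergeometric
  series arise here as moments of the Beta density.\<close>

lemma Beta_shift:
  fixes b d :: real
  assumes "0 < b" "0 < d"
  shows "Beta (b + real n) d = Beta b d * (pochhammer b n / pochhammer (b + d) n)"
proof -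
  have "b \<notin> \<int>\<^sub>\<le>\<^sub>0" "b + d \<notin> \<int>\<^sub>\<le>\<^sub>0" using assms by (auto dest: nonpos_Ints_nonpos)
  moreover have "Gamma b > 0" "Gamma (b + d) > 0" "Gamma (b + d + real n) > 0"
    using assms by (auto intro!: Gamma_real_pos)
  moreover have eq: "b + real n + d = b + d + real n" by simp
  ultimately show ?thesis
    unfolding Beta_def eq by (simp add: pochhammer_Gamma mult.commute)
qed

lemma Beta_real_pos:
  fixes x y :: real
  assumes "0 < x" "0 < y"
  shows "0 < Beta x y"
  using assms by (auto simp: Beta_def intro!: divide_pos_pos mult_pos_pos Gamma_real_pos)

text \<open>The bound \<open>a \<le> 1\<close> gives the Taylor coefficients of
  \<open>box_cox a (1 - r)\<close> a common sign, and \<open>c_gt\<close> makes Euler's integral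
  converge at r = 1.\<close>

locale hyp_mean_params =
  fixes a b c :: real
  assumes a_le: "a \<le> 1" and b_pos: "0 < b" and b_less: "b < c" and c_gt: "b - a < c"
begin

definition pcoeff :: "nat \<Rightarrow> real" where
  "pcoeff n = box_cox_coeff a n * (pochhammer b n / pochhammer c n)"

text \<open>For \<open>a \<noteq> 0\<close> this is (2F1(-a, b; c; r) - 1) / a; for
  \<open>a = 0\<close> it is the logarithm of the mean itself.\<close>

definition hyp_box_cox :: "real \<Rightarrow> real" where
  "hyp_box_cox r = (\<Sum>n. pcoeff n * r ^ n)"

definition hyp_box_cox' :: "real \<Rightarrow> real" where
  "hyp_box_cox' r = (\<Sum>n. diffs pcoeff n * r ^ n)"

definition hyp_box_cox'' :: "real \<Rightarrow> real" where
  "hyp_box_cox'' r = (\<Sum>n. diffs (diffs pcoeff) n * r ^ n)"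

lemma c_pos: "0 < c"
  using b_pos b_less by simp

lemma box_cox_coeff_nonpos: "box_cox_coeff a n \<le> 0"
proof -
  have "0 \<le> pochhammer (1 - a) m" for m
    using a_le unfolding pochhammer_prod by (intro prod_nonneg) auto
  then show ?thesis by (auto simp: box_cox_coeff_def)
qed

lemma pochhammer_ratio: "0 < pochhammer b n / pochhammer c n" "pochhammer b n / pochhammer c n \<le> 1"
proof -
  have pos: "0 < pochhammer b n" "0 < pochhammer c n"
    using b_pos c_pos by (auto intro: pochhammer_pos)
  moreover have "pochhammer b n \<le> pochhammer c n"
    unfolding pochhammer_prod using b_pos b_less by (intro prod_mono) auto
  ultimately show "0 < pochhammer b n / pochhammer c n" "pochhammer b n / pochhammer c n \<le> 1"
    by auto
qed

text \<open>The Pochhammer quotient lies in (0, 1]. The bounds serve twice: for convergence of the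
  series and for positivity of the hypergeometric function.\<close>

lemma pcoeff_bounds: "box_cox_coeff a n \<le> pcoeff n" "pcoeff n \<le> 0"
proof -
  have "box_cox_coeff a n * 1 \<le> pcoeff n"
    unfolding pcoeff_def using pochhammer_ratio[of n] box_cox_coeff_nonpos[of n]
    by (intro mult_left_mono_neg) auto
  then show "box_cox_coeff a n \<le> pcoeff n" by simp
  show "pcoeff n \<le> 0"
    unfolding pcoeff_def using pochhammer_ratio[of n] box_cox_coeff_nonpos[of n]
    by (intro mult_nonpos_nonneg) auto
qed

lemma pcoeff_0 [simp]: "pcoeff 0 = 0"
  by (simp add: pcoeff_def box_cox_coeff_def)

lemma summable_pcoeff:
  assumes "norm r < 1"
  shows "summable (\<lambda>n. pcoeff n * r ^ n)"
proof (rule summable_comparison_test')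
  show "summable (\<lambda>n. - (box_cox_coeff a n * \<bar>r\<bar> ^ n))"
    using box_cox_sums[of "\<bar>r\<bar>" a] assms by (intro summable_minus) (auto simp: sums_iff)
  show "norm (pcoeff n * r ^ n) \<le> - (box_cox_coeff a n * \<bar>r\<bar> ^ n)" if "n \<ge> 0" for n
  proof -
    have "\<bar>pcoeff n\<bar> * \<bar>r\<bar> ^ n \<le> - box_cox_coeff a n * \<bar>r\<bar> ^ n"
      using pcoeff_bounds[of n] by (intro mult_right_mono) auto
    then show ?thesis by (simp add: abs_mult power_abs)
  qed
qed

lemma summable_diffs_pcoeff: "norm r < 1 \<Longrightarrow> summable (\<lambda>n. diffs pcoeff n * r ^ n)"
  using termdiff_converges[of r 1 pcoeff] summable_pcoeff by auto

lemma summable_diffs2_pcoeff: "norm r < 1 \<Longrightarrow> summable (\<lambda>n. diffs (diffs pcoeff) n * r ^ n)"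
  using termdiff_converges[of r 1 "diffs pcoeff"] summable_diffs_pcoeff by auto

lemma hyp_box_cox_deriv: "norm r < 1 \<Longrightarrow> (hyp_box_cox has_real_derivative hyp_box_cox' r) (at r)"
  using termdiffs_strong'[of 1 pcoeff r] summable_pcoeff
  unfolding hyp_box_cox_def[abs_def] hyp_box_cox'_def by simp

lemma hyp_box_cox'_deriv: "norm r < 1 \<Longrightarrow> (hyp_box_cox' has_real_derivative hyp_box_cox'' r) (at r)"
  using termdiffs_strong'[of 1 "diffs pcoeff" r] summable_diffs_pcoeff
  unfolding hyp_box_cox'_def[abs_def] hyp_box_cox''_def by simp

lemma hyp_box_cox_0 [simp]: "hyp_box_cox 0 = 0"
  unfolding hyp_box_cox_def by (simp add: powser_zero)

lemma diffs_pcoeff: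
  "diffs pcoeff n = - pochhammer (1 - a) n / fact n * (pochhammer b (Suc n) / pochhammer c (Suc n))"
  by (simp add: diffs_def pcoeff_def box_cox_coeff_def)

text \<open>Up to the factor -b/c, the differentiated series is 2F1(1 - a, b + 1; c + 1; r), whose
  coefficients obey this recurrence.\<close>

lemma diffs_pcoeff_Suc:
  "real (Suc n) * (c + real (Suc n)) * diffs pcoeff (Suc n) =
   (real (Suc n) - a) * (b + real (Suc n)) * diffs pcoeff n"
proof -
  define m where "m = real (Suc n)"
  define A where "A = pochhammer (1 - a) n"
  define B where "B = pochhammer b (Suc n)"
  define C where "C = pochhammer c (Suc n)"
  define F :: real where "F = fact n"
  define q where "q = c + m"
  have nz: "C \<noteq> 0" "q \<noteq> 0" "F \<noteq> 0" "m \<noteq> 0"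
    using c_pos pochhammer_pos[of c "Suc n"] by (auto simp: C_def m_def F_def q_def)
  have d: "diffs pcoeff n = - A / F * (B / C)"
    unfolding diffs_pcoeff A_def B_def C_def F_def ..
  have "pochhammer (1 - a) (Suc n) = A * (m - a)" "pochhammer b (Suc (Suc n)) = B * (b + m)"
    "pochhammer c (Suc (Suc n)) = C * (c + m)" "fact (Suc n) = m * F"
    unfolding A_def B_def C_def F_def m_def pochhammer_Suc[of _ "Suc n"]
    by (simp_all add: pochhammer_Suc algebra_simps)
  then have d': "diffs pcoeff (Suc n) = - (A * (m - a)) / (m * F) * (B * (b + m) / (C * (c + m)))"
    unfolding diffs_pcoeff by simp
  show ?thesis
    unfolding d d' m_def[symmetric] q_def[symmetric] using nz by (simp add: field_simps)
qed

text \<open>For \<open>a \<noteq> 0\<close> this is the hypergeometric equation of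
  \<open>1 + a * hyp_box_cox r\<close>, divided by \<open>a\<close>. Comparing coefficients gives it
  for \<open>a = 0\<close> as well.\<close>

lemma hypergeometric_ode:
  assumes r: "norm r < 1"
  shows "r * (1 - r) * hyp_box_cox'' r + (c - (1 + b - a) * r) * hyp_box_cox' r + b * (1 + a * hyp_box_cox r) = 0"
proof -
  let ?g = "diffs pcoeff"
  have hyp_box_cox': "(\<lambda>n. ?g n * r ^ n) sums hyp_box_cox' r"
    using summable_diffs_pcoeff[OF r] by (simp add: hyp_box_cox'_def summable_sums)
  have hyp_box_cox: "(\<lambda>n. pcoeff n * r ^ n) sums hyp_box_cox r"
    using summable_pcoeff[OF r] by (simp add: hyp_box_cox_def summable_sums)
  have "(\<lambda>n. r * (diffs ?g n * r ^ n)) sums (r * hyp_box_cox'' r)"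
    using summable_diffs2_pcoeff[OF r] by (intro sums_mult) (simp add: hyp_box_cox''_def summable_sums)
  then have "(\<lambda>n. real (Suc n) * ?g (Suc n) * r ^ Suc n) sums (r * hyp_box_cox'' r)"
    by (simp add: diffs_def mult_ac)
  then have hyp_box_cox'': "(\<lambda>n. real n * ?g n * r ^ n) sums (r * hyp_box_cox'' r)"
    by (subst (asm) sums_Suc_iff) simp
  have X: "(\<lambda>n. real n * ?g n * r ^ n + c * (?g n * r ^ n) + a * b * (pcoeff n * r ^ n) + (if n = 0 then b else 0))
        sums (r * hyp_box_cox'' r + c * hyp_box_cox' r + a * b * hyp_box_cox r + b)"
    using sums_single[of 0 "\<lambda>_. b"] by (intro sums_add hyp_box_cox'' sums_mult hyp_box_cox' hyp_box_cox) auto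
  have "(\<lambda>n. r * (real n * ?g n * r ^ n + (1 + b - a) * (?g n * r ^ n)))
        sums (r * (r * hyp_box_cox'' r + (1 + b - a) * hyp_box_cox' r))"
    by (intro sums_mult sums_add hyp_box_cox' hyp_box_cox'')
  \<comment> \<open>The series without \<open>r\<close> in front is shifted by one index; multiplied
    by \<open>real (Suc n)\<close>, the coefficient identity becomes
    \<open>diffs_pcoeff_Suc\<close>.\<close>
  moreover have "r * (real n * ?g n * r ^ n + (1 + b - a) * (?g n * r ^ n)) =
    real (Suc n) * ?g (Suc n) * r ^ Suc n + c * (?g (Suc n) * r ^ Suc n) +
    a * b * (pcoeff (Suc n) * r ^ Suc n) + (if Suc n = 0 then b else 0)" for n
  proof -
    have p: "pcoeff (Suc n) = ?g n / real (Suc n)" by (simp add: diffs_def)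
    have "(real n + 1 + b - a) * ?g n = (real (Suc n) + c) * ?g (Suc n) + a * b * pcoeff (Suc n)"
    proof -
      have "real (Suc n) * ((real n + 1 + b - a) * ?g n) =
            (real (Suc n) - a) * (b + real (Suc n)) * ?g n + a * b * ?g n"
        by (simp add: algebra_simps)
      also have "\<dots> = real (Suc n) * ((real (Suc n) + c) * ?g (Suc n) + a * b * pcoeff (Suc n))"
        unfolding diffs_pcoeff_Suc[symmetric] p by (simp add: field_simps del: of_nat_Suc)
      finally show ?thesis by (simp del: of_nat_Suc)
    qed
    then have "(real n + 1 + b - a) * ?g n * r ^ Suc n =
               ((real (Suc n) + c) * ?g (Suc n) + a * b * pcoeff (Suc n)) * r ^ Suc n"
      by (rule arg_cong)
    then show ?thesis by (simp add: algebra_simps)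
  qed
  ultimately have "(\<lambda>n. real (Suc n) * ?g (Suc n) * r ^ Suc n + c * (?g (Suc n) * r ^ Suc n) +
    a * b * (pcoeff (Suc n) * r ^ Suc n) + (if Suc n = 0 then b else 0))
      sums (r * (r * hyp_box_cox'' r + (1 + b - a) * hyp_box_cox' r))"
    by simp
  then have "(\<lambda>n. real n * ?g n * r ^ n + c * (?g n * r ^ n) + a * b * (pcoeff n * r ^ n) + (if n = 0 then b else 0))
      sums (r * (r * hyp_box_cox'' r + (1 + b - a) * hyp_box_cox' r) + (c * ?g 0 + b))"
    by (subst (asm) sums_Suc_iff) simp
  \<comment> \<open>The constant term, which the index shift leaves out.\<close>
  moreover have "c * ?g 0 + b = 0"
    using c_pos by (simp add: diffs_pcoeff)
  ultimately have "r * hyp_box_cox'' r + c * hyp_box_cox' r + a * b * hyp_box_cox r + b = r * (r * hyp_box_cox'' r + (1 + b - a) * hyp_box_cox' r)"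
    using X sums_unique2 by fastforce
  then show ?thesis by (simp add: algebra_simps)
qed

lemma hyp_box_cox_ge:
  assumes "0 \<le> r" "r < 1"
  shows "box_cox a (1 - r) \<le> hyp_box_cox r"
proof -
  have "(\<lambda>n. box_cox_coeff a n * r ^ n) sums box_cox a (1 - r)"
    using assms by (intro box_cox_sums) auto
  moreover have "(\<lambda>n. pcoeff n * r ^ n) sums hyp_box_cox r"
    using summable_pcoeff[of r] assms by (simp add: hyp_box_cox_def summable_sums)
  ultimately show ?thesis
    by (rule sums_le[rotated]) (use assms pcoeff_bounds in \<open>auto intro: mult_right_mono\<close>)
qed

lemma hyp_box_cox_nonpos:
  assumes "0 \<le> r" "r < 1"
  shows "hyp_box_cox r \<le> 0"
proof -
  have "(\<lambda>n. pcoeff n * r ^ n) sums hyp_box_cox r"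
    using summable_pcoeff[of r] assms by (simp add: hyp_box_cox_def summable_sums)
  then show ?thesis
    by (rule sums_le[rotated, OF _ sums_zero])
      (use assms pcoeff_bounds in \<open>auto intro: mult_nonpos_nonneg\<close>)
qed

text \<open>For \<open>a \<le> 0\<close> the product is nonnegative. For \<open>a > 0\<close> the
  bound by \<open>box_cox a (1 - r)\<close> keeps the expression above
  \<open>(1 - r) powr a\<close>.\<close>

lemma hyp_pos:
  assumes "0 \<le> r" "r < 1"
  shows "0 < 1 + a * hyp_box_cox r"
proof (cases "a \<le> 0")
  case True
  then show ?thesis using hyp_box_cox_nonpos[OF assms] by (simp add: add_pos_nonneg mult_nonpos_nonpos)
next
  case False
  have "0 < (1 - r) powr a" using assms by simp
  also have "\<dots> = 1 + a * box_cox a (1 - r)" using False by (simp add: box_cox_def)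
  also have "\<dots> \<le> 1 + a * hyp_box_cox r" using hyp_box_cox_ge[OF assms] False by (simp add: mult_left_mono)
  finally show ?thesis .
qed

subsection \<open>Euler's integral and the limit at 1\<close>

definition beta_weight :: "real \<Rightarrow> real" where
  "beta_weight t = t powr (b - 1) * (1 - t) powr (c - b - 1)"

text \<open>Since \<open>0 powr x = 0\<close>, the weight vanishes at t = 1 even where the density
  is unbounded, so pointwise estimates are trivial at that endpoint.\<close>

lemma beta_weight_nonneg: "0 \<le> beta_weight t" and beta_weight_1 [simp]: "beta_weight 1 = 0"
  by (simp_all add: beta_weight_def)

lemma beta_weight_integral: "(beta_weight has_integral Beta b (c - b)) {0..1}"
  unfolding beta_weight_def[abs_def] using has_integral_Beta_real[of b "c - b"] b_pos b_less by simp

lemma beta_weight_power_integral: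
  "((\<lambda>t. beta_weight t * t ^ n) has_integral Beta b (c - b) * (pochhammer b n / pochhammer c n)) {0..1}"
proof -
  have "((\<lambda>t. t powr (b + real n - 1) * (1 - t) powr (c - b - 1)) has_integral Beta (b + real n) (c - b)) {0..1}"
    using has_integral_Beta_real[of "b + real n" "c - b"] b_pos b_less by simp
  moreover have "Beta (b + real n) (c - b) = Beta b (c - b) * (pochhammer b n / pochhammer c n)"
    using Beta_shift[of b "c - b" n] b_pos b_less by simp
  moreover have "t powr (b + real n - 1) * (1 - t) powr (c - b - 1) = beta_weight t * t ^ n" if "t \<in> {0..1}" for t
  proof (cases "t = 0")
    case False
    have "t powr (b + real n - 1) = t powr (b - 1) * t powr real n"
      by (simp add: powr_add[symmetric] algebra_simps)
    then show ?thesis using that False by (simp add: beta_weight_def powr_realpow mult_ac)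
  qed (simp add: beta_weight_def)
  ultimately show ?thesis
    by (metis (no_types, lifting) has_integral_eq)
qed

text \<open>The Taylor series of \<open>box_cox a (1 - r * t)\<close> is integrated term by term
  against the Beta moments. Since the coefficients share a sign, all partial sums are dominated by
  the weight times \<open>- box_cox a (1 - r)\<close>, the value of \<open>?M\<close>.\<close>

lemma euler_integral:
  assumes r: "0 < r" "r < 1"
  shows "((\<lambda>t. beta_weight t * box_cox a (1 - r * t)) has_integral Beta b (c - b) * hyp_box_cox r) {0..1}"
proof (rule has_integral_dominated_convergence)
  let ?M = "\<Sum>n. - (box_cox_coeff a n * r ^ n)"
  have summ: "summable (\<lambda>n. - (box_cox_coeff a n * r ^ n))"
    using box_cox_sums[of r a] r by (intro summable_minus) (auto simp: sums_iff)
  show "((\<lambda>t. \<Sum>n<k. box_cox_coeff a n * r ^ n * (beta_weight t * t ^ n)) has_integral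
          (\<Sum>n<k. box_cox_coeff a n * r ^ n * (Beta b (c - b) * (pochhammer b n / pochhammer c n)))) {0..1}" for k
    by (intro has_integral_sum has_integral_mult_right beta_weight_power_integral) auto
  show "(\<lambda>t. beta_weight t * ?M) integrable_on {0..1}"
    using beta_weight_integral by (intro integrable_on_mult_left) auto
  show "\<forall>t\<in>{0..1}. norm (\<Sum>n<k. box_cox_coeff a n * r ^ n * (beta_weight t * t ^ n)) \<le> beta_weight t * ?M" for k
  proof
    fix t :: real assume t: "t \<in> {0..1}"
    have "norm (\<Sum>n<k. box_cox_coeff a n * r ^ n * (beta_weight t * t ^ n))
          \<le> (\<Sum>n<k. beta_weight t * - (box_cox_coeff a n * r ^ n))"
    proof (rule sum_norm_le)
      fix n
      have "norm (box_cox_coeff a n * r ^ n * (beta_weight t * t ^ n)) = beta_weight t * - (box_cox_coeff a n * r ^ n) * t ^ n"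
        using box_cox_coeff_nonpos[of n] beta_weight_nonneg[of t] t r by (simp add: abs_mult)
      also have "\<dots> \<le> beta_weight t * - (box_cox_coeff a n * r ^ n) * 1"
        using box_cox_coeff_nonpos[of n] beta_weight_nonneg[of t] t r
        by (intro mult_left_mono mult_nonneg_nonneg power_le_one) (auto intro: mult_nonpos_nonneg)
      finally show "norm (box_cox_coeff a n * r ^ n * (beta_weight t * t ^ n)) \<le> beta_weight t * - (box_cox_coeff a n * r ^ n)"
        by simp
    qed
    also have "\<dots> = beta_weight t * (\<Sum>n<k. - (box_cox_coeff a n * r ^ n))"
      by (rule sum_distrib_left[symmetric])
    also have "\<dots> \<le> beta_weight t * ?M"
      using box_cox_coeff_nonpos r
      by (intro mult_left_mono sum_le_suminf summ beta_weight_nonneg) (auto intro: mult_nonpos_nonneg)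
    finally show "norm (\<Sum>n<k. box_cox_coeff a n * r ^ n * (beta_weight t * t ^ n)) \<le> beta_weight t * ?M" .
  qed
  show "\<forall>t\<in>{0..1}. (\<lambda>k. \<Sum>n<k. box_cox_coeff a n * r ^ n * (beta_weight t * t ^ n)) \<longlonglongrightarrow> beta_weight t * box_cox a (1 - r * t)"
  proof
    fix t :: real assume t: "t \<in> {0..1}"
    have "r * t \<le> r * 1" using t r by (intro mult_left_mono) auto
    then have "r * t < 1" using r by linarith
    then have "\<bar>r * t\<bar> < 1" using t r by simp
    from sums_mult[OF box_cox_sums[OF this], of "beta_weight t" a]
    show "(\<lambda>k. \<Sum>n<k. box_cox_coeff a n * r ^ n * (beta_weight t * t ^ n)) \<longlonglongrightarrow> beta_weight t * box_cox a (1 - r * t)"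
      unfolding sums_def by (simp add: power_mult_distrib mult_ac)
  qed
  have "(\<lambda>n. Beta b (c - b) * (pcoeff n * r ^ n)) sums (Beta b (c - b) * hyp_box_cox r)"
    using summable_pcoeff[of r] r by (intro sums_mult) (simp add: hyp_box_cox_def summable_sums)
  then show "(\<lambda>k. \<Sum>n<k. box_cox_coeff a n * r ^ n * (Beta b (c - b) * (pochhammer b n / pochhammer c n)))
     \<longlonglongrightarrow> Beta b (c - b) * hyp_box_cox r"
    unfolding sums_def pcoeff_def by (simp add: mult_ac)
qed

text \<open>Dominated convergence in Euler's integral: \<open>box_cox a\<close> is increasing and
  nonpositive on (0, 1], so its absolute value at \<open>1 - X k * t\<close> is largest for r =
  1.\<close>

lemma hyp_box_cox_tendsto_1:
  "(hyp_box_cox \<longlongrightarrow> integral {0..1} (\<lambda>t. beta_weight t * box_cox a (1 - t)) / Beta b (c - b)) (at_left 1)"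
proof (rule tendsto_at_left_sequentially[of 0])
  fix X :: "nat \<Rightarrow> real"
  assume X: "\<And>n. X n < 1" "\<And>n. 0 < X n" and lim: "X \<longlonglongrightarrow> 1"
  \<comment> \<open>For \<open>a = 0\<close>, a small negative exponent gives an integrable bound for the logarithm.\<close>
  define e where "e = (if a = 0 then - ((c - b) / 2) else a)"
  have e: "e \<noteq> 0" "0 < c - b + e"
    using b_less c_gt by (auto simp: e_def field_simps)
  have e_le: "box_cox e y \<le> box_cox a y" if "0 < y" for y
    using ln_ge_box_cox[OF that, of e] b_less by (auto simp: e_def box_cox_def[of 0])
  let ?B = "Beta b (c - b)"
  have "0 < ?B" using b_pos b_less by (intro Beta_real_pos) auto
  have "((\<lambda>t. t powr (b - 1) * (1 - t) powr (c - b + e - 1)) has_integral Beta b (c - b + e)) {0..1}"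
    using has_integral_Beta_real[of b "c - b + e"] b_pos e by simp
  then have "((\<lambda>t. (beta_weight t - t powr (b - 1) * (1 - t) powr (c - b + e - 1)) / e)
      has_integral (?B - Beta b (c - b + e)) / e) {0..1}"
    by (intro has_integral_divide has_integral_diff beta_weight_integral)
  moreover have "(beta_weight t - t powr (b - 1) * (1 - t) powr (c - b + e - 1)) / e = beta_weight t * - box_cox e (1 - t)"
    if "t \<in> {0..1}" for t
  proof -
    have "(1 - t) powr (c - b + e - 1) = (1 - t) powr (c - b - 1) * (1 - t) powr e"
      by (simp add: powr_add[symmetric] algebra_simps)
    then show ?thesis using e by (simp add: box_cox_def beta_weight_def field_simps)
  qed
  ultimately have int: "(\<lambda>t. beta_weight t * - box_cox e (1 - t)) integrable_on {0..1}"
    by (metis (no_types, lifting) has_integral_eq has_integral_integrable)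
  have "(\<lambda>k. integral {0..1} (\<lambda>t. beta_weight t * box_cox a (1 - X k * t)))
        \<longlonglongrightarrow> integral {0..1} (\<lambda>t. beta_weight t * box_cox a (1 - t))"
  proof (rule dominated_convergence(2)[OF _ int])
    show "(\<lambda>t. beta_weight t * box_cox a (1 - X k * t)) integrable_on {0..1}" for k
      using euler_integral[of "X k"] X by blast
    show "norm (beta_weight t * box_cox a (1 - X k * t)) \<le> beta_weight t * - box_cox e (1 - t)" if t: "t \<in> {0..1}" for k t
    proof (cases "t = 1")
      case False
      have "X k * t \<le> 1 * t" using X[of k] t by (intro mult_right_mono) (auto intro: less_imp_le)
      then have St: "0 < 1 - t" "1 - t \<le> 1 - X k * t" using t False by auto
      have "1 - X k * t \<le> 1" using t X[of k] by auto
      then have "box_cox a (1 - X k * t) \<le> 0"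
        using box_cox_mono[of "1 - X k * t" 1 a] St by auto
      moreover have "box_cox e (1 - t) \<le> box_cox a (1 - X k * t)"
        using e_le[of "1 - t"] box_cox_mono[of "1 - t" "1 - X k * t" a] St by linarith
      ultimately show ?thesis
        using beta_weight_nonneg[of t] by (auto simp: abs_mult intro!: mult_left_mono)
    qed simp
    show "(\<lambda>k. beta_weight t * box_cox a (1 - X k * t)) \<longlonglongrightarrow> beta_weight t * box_cox a (1 - t)" if t: "t \<in> {0..1}" for t
    proof (cases "t = 1")
      case False
      then have "isCont (box_cox a) (1 - t)"
        using continuous_on_box_cox[of a] t by (auto simp: continuous_on_eq_continuous_at)
      moreover have "(\<lambda>k. 1 - X k * t) \<longlonglongrightarrow> 1 - 1 * t" by (intro tendsto_intros lim)
      ultimately show ?thesis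
        by (intro tendsto_intros) (auto intro: isCont_tendsto_compose)
    qed simp
  qed
  moreover have "integral {0..1} (\<lambda>t. beta_weight t * box_cox a (1 - X k * t)) = ?B * hyp_box_cox (X k)" for k
    using euler_integral[of "X k"] X by (intro integral_unique) auto
  ultimately have "(\<lambda>k. ?B * hyp_box_cox (X k) / ?B) \<longlonglongrightarrow> integral {0..1} (\<lambda>t. beta_weight t * box_cox a (1 - t)) / ?B"
    using \<open>0 < ?B\<close> by (intro tendsto_divide) auto
  then show "(\<lambda>k. hyp_box_cox (X k)) \<longlonglongrightarrow> integral {0..1} (\<lambda>t. beta_weight t * box_cox a (1 - t)) / ?B"
    using \<open>0 < ?B\<close> by simp
qed simp

section \<open>The logarithm of the hypergeometric mean\<close>

definition log_hyp :: "real \<Rightarrow> real" where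
  "log_hyp r = (if a = 0 then hyp_box_cox r else ln (1 + a * hyp_box_cox r) / a)"

definition log_hyp' :: "real \<Rightarrow> real" where "log_hyp' r = hyp_box_cox' r / (1 + a * hyp_box_cox r)"

text \<open>The limit of \<open>log_hyp\<close> at 1; \<open>gauss_const\<close> is Gauss's value of
  2F1(-a, b; c; 1).\<close>

definition log_hyp_at_1 :: real where
  "log_hyp_at_1 = (if a = 0 then beta_log_mean b c 1 else ln (gauss_const a b c) / a)"

lemma log_hyp_eq_hyp_box_cox: "a = 0 \<Longrightarrow> log_hyp = hyp_box_cox"
  by (rule ext) (unfold log_hyp_def, rule if_P)

lemma p_end_eq: "p_end a b c = ln (mean_weight b c) / log_hyp_at_1"
  by (simp add: p_end_def log_hyp_at_1_def)

lemma hyp2F1_eq: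
  assumes "norm r < 1"
  shows "hyp2F1 (- a) b c r = 1 + a * hyp_box_cox r"
proof -
  have "fps_nth (fps_hypergeo [- a, b] [c] 1) n = (if n = 0 then 1 else 0) + a * pcoeff n" for n
    by (cases n) (simp_all add: pcoeff_def box_cox_coeff_def pochhammer_rec[of "- a"] algebra_simps)
  then have "(\<lambda>n. fps_nth (fps_hypergeo [- a, b] [c] 1) n * r ^ n)
      = (\<lambda>n. (if n = 0 then 1 else 0) + a * (pcoeff n * r ^ n))"
    by (auto simp: fun_eq_iff algebra_simps)
  moreover have "(\<lambda>n. (if n = 0 then 1 else 0) + a * (pcoeff n * r ^ n)) sums (1 + a * hyp_box_cox r)"
    using summable_pcoeff[OF assms] sums_single[of 0 "\<lambda>_. 1 :: real"]
    by (intro sums_add sums_mult) (auto simp: hyp_box_cox_def summable_sums)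
  ultimately show ?thesis
    by (simp add: hyp2F1_def eval_fps_def sums_iff)
qed

lemma hyp_mean_eq:
  assumes "0 < r" "r < 1"
  shows "hyp_mean a b c r = exp (log_hyp r)"
proof (cases "a = 0")
  case True
  have "integral {0..1} (\<lambda>t. beta_weight t * ln (1 - r * t)) = Beta b (c - b) * hyp_box_cox r"
    using euler_integral[OF assms] True by (intro integral_unique) (simp add: box_cox_def)
  moreover have "0 < Beta b (c - b)" using b_pos b_less by (intro Beta_real_pos) auto
  ultimately have "beta_log_mean b c r = hyp_box_cox r"
    by (simp add: beta_log_mean_def beta_weight_def)
  moreover have "hyp_mean a b c r = exp (beta_log_mean b c r)"
    unfolding hyp_mean_def by (rule if_P[OF True])
  ultimately show ?thesis unfolding log_hyp_eq_hyp_box_cox[OF True] by simp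
next
  case False
  then show ?thesis
    using hyp2F1_eq[of r] hyp_pos[of r] assms by (simp add: hyp_mean_def log_hyp_def powr_def)
qed

lemma log_hyp_deriv:
  assumes "0 \<le> r" "r < 1"
  shows "(log_hyp has_real_derivative log_hyp' r) (at r)"
proof (cases "a = 0")
  case True
  have "log_hyp' r = hyp_box_cox' r" unfolding log_hyp'_def using True by simp
  then show ?thesis
    unfolding log_hyp_eq_hyp_box_cox[OF True] using hyp_box_cox_deriv[of r] assms by simp
next
  case False
  have pos: "0 < 1 + a * hyp_box_cox r" using hyp_pos[OF assms] .
  show ?thesis
    unfolding log_hyp_def[abs_def] log_hyp'_def using False pos hyp_box_cox_deriv[of r] assms
    by (auto intro!: derivative_eq_intros)
qed

lemma log_hyp'_deriv:
  assumes "0 \<le> r" "r < 1"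
  shows "(log_hyp' has_real_derivative (hyp_box_cox'' r / (1 + a * hyp_box_cox r) - a * (log_hyp' r)\<^sup>2)) (at r)"
proof -
  have pos: "0 < 1 + a * hyp_box_cox r" using hyp_pos[OF assms] .
  have F: "((\<lambda>r. 1 + a * hyp_box_cox r) has_real_derivative a * hyp_box_cox' r) (at r)"
    using hyp_box_cox_deriv[of r] assms by (auto intro!: derivative_eq_intros)
  have eq: "(d * f - g * (a * g)) / (f * f) = d / f - a * (g / f)\<^sup>2" if "0 < f" for d f g :: real
    using that by (simp add: field_simps power2_eq_square)
  show ?thesis
    unfolding log_hyp'_def[abs_def]
    by (rule DERIV_cong[OF DERIV_divide[OF hyp_box_cox'_deriv F]]) (use pos assms eq in auto)
qed

text \<open>The differential equation divided by \<open>1 + a * hyp_box_cox r\<close>. Inserted into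
  \<open>log_hyp'_deriv\<close>, it yields the Riccati equation for \<open>log_hyp'\<close>.\<close>

lemma riccati:
  assumes "0 < r" "r < 1"
  shows "hyp_box_cox'' r / (1 + a * hyp_box_cox r) = - ((c - (1 + b - a) * r) * log_hyp' r + b) / (r * (1 - r))"
proof -
  have pos: "0 < 1 + a * hyp_box_cox r" using hyp_pos[of r] assms by simp
  have uF: "log_hyp' r * (1 + a * hyp_box_cox r) = hyp_box_cox' r" using pos by (simp add: log_hyp'_def)
  have "hyp_box_cox'' r * (r * (1 - r)) = - ((c - (1 + b - a) * r) * hyp_box_cox' r + b * (1 + a * hyp_box_cox r))"
    using hypergeometric_ode[of r] assms by (simp add: mult.commute)
  also have "\<dots> = - ((c - (1 + b - a) * r) * log_hyp' r + b) * (1 + a * hyp_box_cox r)"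
    unfolding uF[symmetric] by (simp only: minus_mult_left[symmetric] distrib_right mult.assoc)
  finally show ?thesis using pos assms by (simp add: frac_eq_eq)
qed

text \<open>For \<open>a \<noteq> 0\<close> the limiting integral is a difference of two Beta values
  divided by \<open>a\<close>, which proves Gauss's summation formula.\<close>

lemma log_hyp_tendsto_1: "(log_hyp \<longlongrightarrow> log_hyp_at_1) (at_left 1)"
proof (cases "a = 0")
  case True
  have "beta_log_mean b c 1 = integral {0..1} (\<lambda>t. beta_weight t * box_cox a (1 - t)) / Beta b (c - b)"
    unfolding beta_log_mean_def beta_weight_def box_cox_def using True by simp
  moreover have "log_hyp_at_1 = beta_log_mean b c 1" unfolding log_hyp_at_1_def by (rule if_P[OF True])
  ultimately show ?thesis
    unfolding log_hyp_eq_hyp_box_cox[OF True] using hyp_box_cox_tendsto_1 by (simp only:)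
next
  case False
  have eq: "(x - y) / a / y = (x / y - 1) / a" if "0 < y" for x y :: real
    using that False by (simp add: field_simps)
  have B: "0 < Beta b (c - b)" "0 < Beta b (c - b + a)"
    using b_pos b_less c_gt by (auto intro!: Beta_real_pos)
  have "((\<lambda>t. t powr (b - 1) * (1 - t) powr (c - b + a - 1)) has_integral Beta b (c - b + a)) {0..1}"
    using has_integral_Beta_real[of b "c - b + a"] b_pos c_gt by simp
  then have "((\<lambda>t. (t powr (b - 1) * (1 - t) powr (c - b + a - 1) - beta_weight t) / a)
      has_integral (Beta b (c - b + a) - Beta b (c - b)) / a) {0..1}"
    by (intro has_integral_divide has_integral_diff beta_weight_integral)
  moreover have "(t powr (b - 1) * (1 - t) powr (c - b + a - 1) - beta_weight t) / a = beta_weight t * box_cox a (1 - t)" for t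
  proof -
    have "(1 - t) powr (c - b + a - 1) = (1 - t) powr (c - b - 1) * (1 - t) powr a"
      by (simp add: powr_add[symmetric] algebra_simps)
    then show ?thesis using False by (simp add: box_cox_def beta_weight_def field_simps)
  qed
  ultimately have "integral {0..1} (\<lambda>t. beta_weight t * box_cox a (1 - t)) = (Beta b (c - b + a) - Beta b (c - b)) / a"
    by (simp add: integral_unique)
  then have "(hyp_box_cox \<longlongrightarrow> (Beta b (c - b + a) / Beta b (c - b) - 1) / a) (at_left 1)"
    using hyp_box_cox_tendsto_1 eq[OF B(1)] by (simp only:)
  then have "((\<lambda>r. ln (1 + a * hyp_box_cox r) / a) \<longlongrightarrow>
      ln (1 + a * ((Beta b (c - b + a) / Beta b (c - b) - 1) / a)) / a) (at_left 1)"
    using False B by (intro tendsto_intros) auto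
  moreover have "Beta b (c - b + a) / Beta b (c - b) = gauss_const a b c"
  proof -
    have "0 < Gamma b" "0 < Gamma c" using b_pos c_pos by (auto intro!: Gamma_real_pos)
    then show ?thesis
      by (simp add: Beta_def gauss_const_def algebra_simps)
  qed
  ultimately show ?thesis using False by (simp add: log_hyp_def[abs_def] log_hyp_at_1_def)
qed

subsection \<open>The logarithmic derivatives of the two means\<close>

abbreviation w :: real where "w \<equiv> mean_weight b c"

text \<open>Used as the logarithm of the power mean for \<open>p > 0\<close> only; other exponents
  are reduced to these by positivity of the critical exponents and
  \<open>power_mean_mono\<close>.\<close>

definition log_power :: "real \<Rightarrow> real \<Rightarrow> real" where
  "log_power p r = ln (w + (1 - w) * (1 - r) powr p) / p"

definition log_power' :: "real \<Rightarrow> real \<Rightarrow> real" where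
  "log_power' p r = - ((1 - w) * (1 - r) powr (p - 1)) / (w + (1 - w) * (1 - r) powr p)"

definition log_power'' :: "real \<Rightarrow> real \<Rightarrow> real" where
  "log_power'' p r = ((1 - w) * ((p - 1) * (1 - r) powr (p - 2)) * (w + (1 - w) * (1 - r) powr p)
     - (1 - w) * (1 - r) powr (p - 1) * ((1 - w) * (p * (1 - r) powr (p - 1))))
     / (w + (1 - w) * (1 - r) powr p)\<^sup>2"

text \<open>
  Up to a positive factor, the error with which \<open>log_power' p\<close> solves the Riccati equation of \<open>log_hyp'\<close>;
  a fifth power, \<open>(1 - r) powr (p + 1)\<close>, cancels because \<open>1 - w = b / c\<close>.
\<close>
definition defect_factor :: "real \<Rightarrow> real \<Rightarrow> real" where
  "defect_factor p r = (c - b) * (1 - r) powr (1 - p) - (c + a - b - p) + (a + b - p) * (1 - r) - b * (1 - r) powr p"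

lemma w_bounds: "0 < w" "w < 1"
  using b_pos b_less by (auto simp: mean_weight_def)

lemma weighted_sum_pos: "r < 1 \<Longrightarrow> 0 < w + (1 - w) * (1 - r) powr p"
  using w_bounds by (intro add_pos_pos) auto

lemma power_mean_eq:
  assumes "0 < p" "r < 1"
  shows "power_mean p w (1 - r) = exp (log_power p r)"
  using assms weighted_sum_pos[of r p] by (simp add: power_mean_def log_power_def powr_def)

lemma log_power_deriv:
  assumes "0 < p" "r < 1"
  shows "(log_power p has_real_derivative log_power' p r) (at r)"
proof -
  have "((\<lambda>r. w + (1 - w) * (1 - r) powr p) has_real_derivative - ((1 - w) * (p * (1 - r) powr (p - 1)))) (at r)"
    using assms by (auto intro!: derivative_eq_intros)
  note D = DERIV_cdivide[OF DERIV_ln_divide[THEN DERIV_chain2, OF weighted_sum_pos[OF assms(2)] this], of p]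
  show ?thesis
    unfolding log_power_def[abs_def] by (rule DERIV_cong[OF D]) (use assms in \<open>simp add: log_power'_def\<close>)
qed

lemma log_power'_deriv:
  assumes "r < 1"
  shows "(log_power' p has_real_derivative log_power'' p r) (at r)"
proof -
  have N: "((\<lambda>r. w + (1 - w) * (1 - r) powr p) has_real_derivative - ((1 - w) * (p * (1 - r) powr (p - 1)))) (at r)"
    using assms by (auto intro!: derivative_eq_intros)
  have M: "((\<lambda>r. - ((1 - w) * (1 - r) powr (p - 1))) has_real_derivative
      (1 - w) * ((p - 1) * (1 - r) powr (p - 2))) (at r)"
    using assms by (auto intro!: derivative_eq_intros)
  show ?thesis
    unfolding log_power'_def[abs_def]
    by (rule DERIV_cong[OF DERIV_divide[OF M N]])
      (use weighted_sum_pos[OF assms, of p] in \<open>auto simp: log_power''_def power2_eq_square\<close>)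
qed

lemma defect:
  assumes r: "0 < r" "r < 1"
  shows "log_power'' p r + a * (log_power' p r)\<^sup>2 + ((c - (1 + b - a) * r) * log_power' p r + b) / (r * (1 - r))
    = b * (c - b) * (1 - r) powr (p - 1) / (r * (1 - r) * (c - b + b * (1 - r) powr p)\<^sup>2) * defect_factor p r"
proof -
  define x where "x = 1 - r"
  define y where "y = x powr p"
  define M where "M = c - b + b * y"
  have x: "0 < x" "x < 1" "r = 1 - x" using r by (auto simp: x_def)
  have y: "0 < y" using x by (simp add: y_def)
  have M: "0 < M" unfolding M_def using b_pos b_less y by (intro add_pos_pos) auto
  \<comment> \<open>All powers become rational in \<open>x\<close> and \<open>y\<close>, so that
    after clearing denominators the claim is a polynomial identity.\<close>
  have e1: "x powr (p - 1) = y / x" and e2: "x powr (p - 2) = y / x\<^sup>2" and e3: "x powr (1 - p) = x / y"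
    using x by (simp_all add: y_def powr_diff powr_numeral)
  have N: "w + (1 - w) * y = M / c" and s: "1 - w = b / c"
    using c_pos by (simp_all add: mean_weight_def M_def field_simps)
  have log_power': "log_power' p r = - b * y / (x * M)"
    unfolding log_power'_def x_def[symmetric] y_def[symmetric] e1 N unfolding s
    using c_pos x M by (simp add: field_simps)
  have log_power'': "log_power'' p r = b * y * ((p - 1) * M - b * p * y) / (x\<^sup>2 * M\<^sup>2)"
    unfolding log_power''_def x_def[symmetric] y_def[symmetric] e1 e2 N unfolding s
    using c_pos x M by (simp add: field_simps power2_eq_square)
  \<comment> \<open>The factor \<open>y\<close> clears the denominator of
    \<open>x powr (1 - p) = x / y\<close>.\<close>
  have yk: "y * defect_factor p r = (c - b) * x - (c + a - b - p) * y + (a + b - p) * x * y - b * y\<^sup>2"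
    unfolding defect_factor_def x_def[symmetric] y_def[symmetric] e3 using y by (simp add: field_simps power2_eq_square)
  have "(log_power'' p r + a * (log_power' p r)\<^sup>2 + ((c - (1 + b - a) * r) * log_power' p r + b) / (r * x)) * (r * x\<^sup>2 * M\<^sup>2)
    = log_power'' p r * (x\<^sup>2 * M\<^sup>2) * r + a * r * (log_power' p r * (x * M))\<^sup>2
      + (c - (1 + b - a) * r) * (log_power' p r * (x * M)) * M + b * x * M\<^sup>2"
    using x r by (simp add: field_simps power2_eq_square)
  also have "log_power'' p r * (x\<^sup>2 * M\<^sup>2) = b * y * ((p - 1) * M - b * p * y)"
    using log_power'' x M by simp
  also have "log_power' p r * (x * M) = - b * y"
    using log_power' x M by simp
  also have "b * y * ((p - 1) * M - b * p * y) * r + a * r * (- b * y)\<^sup>2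
      + (c - (1 + b - a) * r) * (- b * y) * M + b * x * M\<^sup>2 = b * (c - b) * (y * defect_factor p r)"
    unfolding yk unfolding M_def x(3) by algebra
  also have "\<dots> = b * (c - b) * (y / x) / (r * x * M\<^sup>2) * defect_factor p r * (r * x\<^sup>2 * M\<^sup>2)"
    using x M r by (simp add: field_simps power2_eq_square)
  finally have "(log_power'' p r + a * (log_power' p r)\<^sup>2 + ((c - (1 + b - a) * r) * log_power' p r + b) / (r * x)) * (r * x\<^sup>2 * M\<^sup>2)
    = b * (c - b) * (y / x) / (r * x * M\<^sup>2) * defect_factor p r * (r * x\<^sup>2 * M\<^sup>2)" .
  moreover have "r * x\<^sup>2 * M\<^sup>2 \<noteq> 0" using x M r by simp
  ultimately show ?thesis
    unfolding x_def[symmetric] y_def[symmetric] e1 M_def[symmetric] using mult_right_cancel by blast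
qed

text \<open>
  The difference of two solutions of a Riccati equation satisfies a linear equation, for which this is an
  integrating factor. It vanishes at \<open>r = 0\<close> because \<open>c > 0\<close>.
\<close>
definition integ_factor :: "real \<Rightarrow> real \<Rightarrow> real" where
  "integ_factor p r = r powr c * (1 - r) powr (1 + b - a - c) * exp (a * (log_hyp r + log_power p r))"

definition scaled_gap :: "real \<Rightarrow> real \<Rightarrow> real" where
  "scaled_gap p r = integ_factor p r * (log_hyp' r - log_power' p r)"

text \<open>The quadratic terms of the two equations differ by a(u^2 - v^2) = a(u + v)(u - v), hence
  the exponential of \<open>a * (log_hyp r + log_power p r)\<close>. The powers of \<open>r\<close>
  and \<open>1 - r\<close> integrate the linear coefficient by partial fractions, and only the
  defect remains.\<close>

lemma scaled_gap_deriv: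
  assumes p: "0 < p" and r: "0 < r" "r < 1"
  shows "\<exists>m>0. (scaled_gap p has_real_derivative - (m * defect_factor p r)) (at r)"
proof -
  define x where "x = 1 - r"
  have x: "0 < x" "r = 1 - x" using r by (auto simp: x_def)
  define m where "m = integ_factor p r * (b * (c - b) * x powr (p - 1) / (r * x * (c - b + b * x powr p)\<^sup>2))"
  have integ_factor: "0 < integ_factor p r" using r by (simp add: integ_factor_def)
  have "0 < c - b + b * x powr p" using b_pos b_less x by (intro add_pos_pos) auto
  then have m: "0 < m"
    unfolding m_def using integ_factor b_pos b_less x r by simp
  have log_hyp: "(log_hyp has_real_derivative log_hyp' r) (at r)" using log_hyp_deriv r by simp
  have log_power: "(log_power p has_real_derivative log_power' p r) (at r)" using log_power_deriv p r by simp
  have d1: "((\<lambda>r. r powr c) has_real_derivative r powr c * (c / r)) (at r)"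
    using r by (auto intro!: derivative_eq_intros simp: powr_diff)
  define e where "e = 1 + b - a - c"
  have d2: "((\<lambda>r. (1 - r) powr e) has_real_derivative (1 - r) powr e * (- e / x)) (at r)"
    using r by (auto intro!: derivative_eq_intros simp: powr_diff x_def)
  have d3: "((\<lambda>r. exp (a * (log_hyp r + log_power p r))) has_real_derivative
      exp (a * (log_hyp r + log_power p r)) * (a * (log_hyp' r + log_power' p r))) (at r)"
    by (auto intro!: derivative_eq_intros log_hyp log_power)
  have mu': "(integ_factor p has_real_derivative integ_factor p r * (c / r + (c + a - b - 1) / x + a * (log_hyp' r + log_power' p r))) (at r)"
    unfolding integ_factor_def[abs_def]
    by (rule DERIV_cong[OF DERIV_mult[OF DERIV_mult[OF d1 d2[unfolded e_def]] d3]])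
      (simp add: algebra_simps add_divide_distrib diff_divide_distrib)
  have u': "(log_hyp' has_real_derivative (- ((c - (1 + b - a) * r) * log_hyp' r + b) / (r * x) - a * (log_hyp' r)\<^sup>2)) (at r)"
    using log_hyp'_deriv[of r] riccati[of r] r by (simp add: x_def)
  have S': "(scaled_gap p has_real_derivative
      integ_factor p r * (c / r + (c + a - b - 1) / x + a * (log_hyp' r + log_power' p r)) * (log_hyp' r - log_power' p r)
      + (- ((c - (1 + b - a) * r) * log_hyp' r + b) / (r * x) - a * (log_hyp' r)\<^sup>2 - log_power'' p r) * integ_factor p r) (at r)"
    unfolding scaled_gap_def[abs_def] by (intro DERIV_mult DERIV_diff mu' u' log_power'_deriv r)
  have q: "c / r + (c + a - b - 1) / x = (c - (1 + b - a) * r) / (r * x)"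
  proof -
    have "c * x + (c + a - b - 1) * r = c - (1 + b - a) * r"
      by (simp add: x_def algebra_simps)
    then show ?thesis using x(1) r by (simp add: add_frac_eq)
  qed
  have vd: "log_power'' p r = b * (c - b) * x powr (p - 1) / (r * x * (c - b + b * x powr p)\<^sup>2) * defect_factor p r
      - a * (log_power' p r)\<^sup>2 - ((c - (1 + b - a) * r) * log_power' p r + b) / (r * x)"
    using defect[OF r, of p] by (simp add: x_def)
  have alg: "z * (Q / R + a * (x' + y')) * (x' - y')
      + (- (Q * x' + b) / R - a * x'\<^sup>2 - (D - a * y'\<^sup>2 - (Q * y' + b) / R)) * z = - (z * D)"
    for z Q R x' y' D :: real
    unfolding divide_inverse by algebra
  have "integ_factor p r * (c / r + (c + a - b - 1) / x + a * (log_hyp' r + log_power' p r)) * (log_hyp' r - log_power' p r)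
      + (- ((c - (1 + b - a) * r) * log_hyp' r + b) / (r * x) - a * (log_hyp' r)\<^sup>2 - log_power'' p r) * integ_factor p r
      = - (m * defect_factor p r)"
    unfolding q vd m_def by (rule trans[OF alg]) (simp only: mult.assoc)
  with S' m show ?thesis by metis
qed

lemma scaled_gap_tendsto_0:
  assumes "0 < p"
  shows "(scaled_gap p \<longlongrightarrow> 0) (at_right 0)"
proof -
  have "isCont (\<lambda>r. (1 - r) powr (1 + b - a - c) * exp (a * (log_hyp r + log_power p r)) * (log_hyp' r - log_power' p r)) 0"
    using DERIV_isCont[OF log_hyp_deriv[of 0]] DERIV_isCont[OF log_power_deriv[OF assms, of 0]]
      DERIV_isCont[OF log_hyp'_deriv[of 0]] DERIV_isCont[OF log_power'_deriv[of 0 p]]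
    by (intro continuous_intros) auto
  note A = isCont_imp_tendsto_at_right[OF this]
  have B: "((\<lambda>r. r powr c) \<longlongrightarrow> 0) (at_right 0)"
    by (rule tendsto_zero_powrI[where b = c])
      (auto intro!: tendsto_intros c_pos simp: eventually_at_right_field intro: exI[of _ 1])
  show ?thesis
    using tendsto_mult[OF B A] by (simp add: scaled_gap_def[abs_def] integ_factor_def mult.assoc)
qed

lemma diff_tendsto_0:
  assumes "0 < p"
  shows "((\<lambda>r. log_hyp r - log_power p r) \<longlongrightarrow> 0) (at_right 0)"
proof -
  have cont: "isCont (\<lambda>r. log_hyp r - log_power p r) 0"
    using DERIV_isCont[OF log_hyp_deriv[of 0]] DERIV_isCont[OF log_power_deriv[OF assms, of 0]]
    by (intro continuous_intros) auto
  have "log_hyp 0 = 0"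
  proof (cases "a = 0")
    case True
    show ?thesis unfolding log_hyp_eq_hyp_box_cox[OF True] by (rule hyp_box_cox_0)
  qed (simp add: log_hyp_def)
  then have "log_hyp 0 - log_power p 0 = 0" by (simp add: log_power_def)
  with isCont_imp_tendsto_at_right[OF cont] show ?thesis by (simp only:)
qed

lemma log_power_tendsto_1:
  assumes "0 < p"
  shows "(log_power p \<longlongrightarrow> ln w / p) (at_left 1)"
proof -
  have "((\<lambda>r. (1 - r) powr p) \<longlongrightarrow> 0) (at_left 1)"
    by (rule tendsto_zero_powrI[where b = p])
      (auto intro!: tendsto_eq_intros assms simp: eventually_at_left_field intro: exI[of _ 0])
  then have "((\<lambda>r. ln (w + (1 - w) * (1 - r) powr p) / p) \<longlongrightarrow> ln (w + (1 - w) * 0) / p) (at_left 1)"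
    using w_bounds assms by (intro tendsto_intros) auto
  then show ?thesis by (simp add: log_power_def[abs_def])
qed

lemma diff_tendsto_1:
  assumes "0 < p"
  shows "((\<lambda>r. log_hyp r - log_power p r) \<longlongrightarrow> log_hyp_at_1 - ln w / p) (at_left 1)"
  by (intro tendsto_diff log_hyp_tendsto_1 log_power_tendsto_1 assms)

lemma diff_deriv:
  assumes "0 < p" "0 < r" "r < 1"
  shows "((\<lambda>r. log_hyp r - log_power p r) has_real_derivative log_hyp' r - log_power' p r) (at r)"
  by (intro DERIV_diff log_hyp_deriv log_power_deriv) (use assms in auto)

lemma scaled_gap_sgn:
  assumes "0 < r" "r < 1"
  shows "\<exists>m>0. log_hyp' r - log_power' p r = m * scaled_gap p r"
proof -
  have "0 < integ_factor p r" using assms by (simp add: integ_factor_def)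
  then show ?thesis by (intro exI[of _ "1 / integ_factor p r"]) (simp add: scaled_gap_def)
qed

subsection \<open>Sharp exponents\<close>

text \<open>Chooses the positive factor as a function of \<open>r\<close>, so that the sign pattern
  lemmas apply.\<close>

lemma sgn_scaled_gap_deriv:
  assumes "0 < p"
  obtains m where "\<And>r. 0 < r \<Longrightarrow> r < 1 \<Longrightarrow> 0 < m r"
    "\<And>r. 0 < r \<Longrightarrow> r < 1 \<Longrightarrow> ((\<lambda>r. s * scaled_gap p r) has_real_derivative m r * (- (s * defect_factor p r))) (at r)"
proof -
  have "\<forall>r\<in>{0<..<1}. \<exists>m>0. (scaled_gap p has_real_derivative - (m * defect_factor p r)) (at r)"
    using scaled_gap_deriv[OF assms] by auto
  then obtain m where m: "\<forall>r\<in>{0<..<1}. m r > 0 \<and> (scaled_gap p has_real_derivative - (m r * defect_factor p r)) (at r)"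
    using bchoice by meson
  have "((\<lambda>r. s * scaled_gap p r) has_real_derivative m r * (- (s * defect_factor p r))) (at r)" if "0 < r" "r < 1" for r
    using m that by (auto intro!: derivative_eq_intros)
  with m show ?thesis using that[of m] by auto
qed

lemma sgn_scaled_gap_tendsto_0: "0 < p \<Longrightarrow> ((\<lambda>r. s * scaled_gap p r) \<longlongrightarrow> 0) (at_right 0)"
  using tendsto_mult_right_zero[OF scaled_gap_tendsto_0] by blast

lemma sgn_diff_tendsto_0: "0 < p \<Longrightarrow> ((\<lambda>r. s * (log_hyp r - log_power p r)) \<longlongrightarrow> 0) (at_right 0)"
  using tendsto_mult_right_zero[OF diff_tendsto_0] by blast

lemma sgn_diff_deriv:
  assumes "0 < p" "0 < r" "r < 1"
  shows "((\<lambda>r. s * (log_hyp r - log_power p r)) has_real_derivative s * (log_hyp' r - log_power' p r)) (at r)"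
  by (intro DERIV_cmult diff_deriv assms)

lemma sgn_mult_scaled_gap:
  assumes "0 < r" "r < 1"
  shows "\<exists>m>0. s * (log_hyp' r - log_power' p r) = m * (s * scaled_gap p r)"
  using scaled_gap_sgn[OF assms, of p] by (auto simp: mult.left_commute)

text \<open>
  The sign \<open>s\<close> lets one argument serve both orders of \<open>p_zero\<close> and \<open>p_end\<close>.
\<close>
lemma diff_sgn:
  assumes p: "0 < p" and k: "\<And>r. 0 < r \<Longrightarrow> r < 1 \<Longrightarrow> 0 < s * defect_factor p r"
  shows "\<And>r. 0 < r \<Longrightarrow> r < 1 \<Longrightarrow> s * (log_hyp r - log_power p r) < 0" and "s * (log_hyp_at_1 - ln w / p) < 0"
proof -
  obtain m where m: "\<And>r. 0 < r \<Longrightarrow> r < 1 \<Longrightarrow> 0 < m r"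
    "\<And>r. 0 < r \<Longrightarrow> r < 1 \<Longrightarrow> ((\<lambda>r. s * scaled_gap p r) has_real_derivative m r * (- (s * defect_factor p r))) (at r)"
    by (rule sgn_scaled_gap_deriv[OF p, where s = s]) blast
  have scaled_gap: "s * scaled_gap p r < 0" if "0 < r" "r < 1" for r
  proof (rule neg_of_deriv_neg[OF sgn_scaled_gap_tendsto_0[OF p] m(2) _ that])
    show "m r * - (s * defect_factor p r) < 0" if "0 < r" "r < 1" for r
      using m(1)[OF that] k[OF that] by (intro mult_pos_neg) auto
  qed auto
  have neg: "s * (log_hyp' r - log_power' p r) < 0" if "0 < r" "r < 1" for r
  proof -
    from sgn_mult_scaled_gap[OF that] obtain z where "0 < z" "s * (log_hyp' r - log_power' p r) = z * (s * scaled_gap p r)"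
      by blast
    then show ?thesis using scaled_gap[OF that] by (simp only: mult_pos_neg)
  qed
  show "s * (log_hyp r - log_power p r) < 0" if "0 < r" "r < 1" for r
    by (rule neg_of_deriv_neg[OF sgn_diff_tendsto_0[OF p] sgn_diff_deriv[OF p] neg that]) auto
  show "s * (log_hyp_at_1 - ln w / p) < 0"
    by (rule neg_limit_of_deriv_neg[OF sgn_diff_tendsto_0[OF p] _ sgn_diff_deriv[OF p] neg])
      (intro tendsto_mult tendsto_const diff_tendsto_1 p)
qed

text \<open>A local version of \<open>diff_sgn\<close>: the sign near 0 alone decides on which side
  of \<open>p_zero\<close> an admissible exponent lies.\<close>

lemma diff_eventually_sgn:
  assumes p: "0 < p" and k: "\<forall>\<^sub>F r in at_right 0. 0 < s * defect_factor p r"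
  shows "\<forall>\<^sub>F r in at_right 0. s * (log_hyp r - log_power p r) < 0"
proof -
  obtain m where m: "\<And>r. 0 < r \<Longrightarrow> r < 1 \<Longrightarrow> 0 < m r"
    "\<And>r. 0 < r \<Longrightarrow> r < 1 \<Longrightarrow> ((\<lambda>r. s * scaled_gap p r) has_real_derivative m r * (- (s * defect_factor p r))) (at r)"
    by (rule sgn_scaled_gap_deriv[OF p, where s = s]) blast
  have ev: "\<forall>\<^sub>F r in at_right 0. (0::real) < r \<and> r < 1"
    unfolding eventually_at_right_field by (intro exI[of _ 1]) auto
  have "\<forall>\<^sub>F r in at_right 0. m r * (- (s * defect_factor p r)) < 0"
    using k ev by eventually_elim (use m(1) in \<open>auto intro: mult_pos_neg\<close>)
  then have "\<forall>\<^sub>F r in at_right 0. s * scaled_gap p r < 0"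
    by (rule eventually_neg_of_deriv_neg[OF sgn_scaled_gap_tendsto_0[OF p] m(2), rotated -1])
  with ev have "\<forall>\<^sub>F r in at_right 0. s * (log_hyp' r - log_power' p r) < 0"
  proof eventually_elim
    case (elim r)
    obtain z where "0 < z" "s * (log_hyp' r - log_power' p r) = z * (s * scaled_gap p r)"
      using sgn_mult_scaled_gap[of r s p] elim by blast
    then show ?case using elim by (simp only: mult_pos_neg)
  qed
  then show ?thesis
    by (rule eventually_neg_of_deriv_neg[OF sgn_diff_tendsto_0[OF p] sgn_diff_deriv[OF p], rotated -1])
qed

text \<open>The pattern passes from the defect to the scaled gap by integration and to
  \<open>log_hyp' - log_power'\<close> by a positive factor. The equal limits at 1 then exclude a
  nonnegative value of the difference.\<close>

lemma diff_sgn_crossing: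
  assumes p: "0 < p" and k: "neg_then_pos (\<lambda>r. - (s * defect_factor p r))" and lim: "log_hyp_at_1 = ln w / p"
    and r: "0 < r" "r < 1"
  shows "s * (log_hyp r - log_power p r) < 0"
proof -
  obtain m where m: "\<And>r. 0 < r \<Longrightarrow> r < 1 \<Longrightarrow> 0 < m r"
    "\<And>r. 0 < r \<Longrightarrow> r < 1 \<Longrightarrow> ((\<lambda>r. s * scaled_gap p r) has_real_derivative m r * (- (s * defect_factor p r))) (at r)"
    by (rule sgn_scaled_gap_deriv[OF p, where s = s]) blast
  have "neg_then_pos (\<lambda>r. m r * (- (s * defect_factor p r)))"
    by (rule neg_then_pos_cong[OF k]) (use m(1) in auto)
  then have "neg_then_pos (\<lambda>r. s * scaled_gap p r)"
    by (rule neg_then_pos_of_deriv[OF sgn_scaled_gap_tendsto_0[OF p] m(2), rotated -1])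
  then have "neg_then_pos (\<lambda>r. s * (log_hyp' r - log_power' p r))"
    by (rule neg_then_pos_cong) (rule sgn_mult_scaled_gap)
  moreover have "((\<lambda>r. s * (log_hyp r - log_power p r)) \<longlongrightarrow> 0) (at_left 1)"
    using tendsto_mult[OF tendsto_const diff_tendsto_1[OF p], of s] lim by simp
  ultimately show ?thesis
    using neg_of_neg_then_pos_deriv[OF sgn_diff_tendsto_0[OF p] _ sgn_diff_deriv[OF p] _ r] by blast
qed

lemma diff_zero:
  assumes p: "0 < p" and k: "\<And>r. 0 < r \<Longrightarrow> r < 1 \<Longrightarrow> defect_factor p r = 0"
  shows "\<And>r. 0 < r \<Longrightarrow> r < 1 \<Longrightarrow> log_hyp r = log_power p r" and "log_hyp_at_1 = ln w / p"
proof -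
  have "scaled_gap p r = 0" if "0 < r" "r < 1" for r
  proof (rule zero_of_deriv_zero[OF scaled_gap_tendsto_0[OF p] _ that])
    show "(scaled_gap p has_real_derivative 0) (at r)" if "0 < r" "r < 1" for r
      using scaled_gap_deriv[OF p that] k[OF that] by auto
  qed
  then have "log_hyp' r - log_power' p r = 0" if "0 < r" "r < 1" for r
    using scaled_gap_sgn[OF that, of p] that by auto
  then have eq: "log_hyp r - log_power p r = 0" if "0 < r" "r < 1" for r
    using zero_of_deriv_zero[OF diff_tendsto_0[OF p] _ that] diff_deriv[OF p] by metis
  then show "log_hyp r = log_power p r" if "0 < r" "r < 1" for r using that by fastforce
  have "\<forall>\<^sub>F r in at_left 1. log_hyp r - log_power p r = 0"
    unfolding eventually_at_left_field using eq by (intro exI[of _ 0]) auto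
  then have "((\<lambda>r. log_hyp r - log_power p r) \<longlongrightarrow> 0) (at_left 1)"
    by (rule tendsto_eventually)
  then have "log_hyp_at_1 - ln w / p = 0"
    using diff_tendsto_1[OF p] tendsto_unique trivial_limit_at_left_real by blast
  then show "log_hyp_at_1 = ln w / p" by simp
qed

section \<open>Sign of the defect factor\<close>

definition defect_factor' :: "real \<Rightarrow> real \<Rightarrow> real" where
  "defect_factor' p r = - ((c - b) * ((1 - p) * (1 - r) powr (- p))) - (a + b - p) + b * (p * (1 - r) powr (p - 1))"

text \<open>Factored so that for 0 < p < 1 the sign is that of the last factor, whose exponent
  \<open>1 - 2 * p\<close> changes sign at p = 1/2.\<close>

definition defect_factor'' :: "real \<Rightarrow> real \<Rightarrow> real" where
  "defect_factor'' p r = p * (1 - p) * (1 - r) powr (p - 2) * (b - (c - b) * (1 - r) powr (1 - 2 * p))"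

lemma defect_factor_deriv: "r < 1 \<Longrightarrow> (defect_factor p has_real_derivative defect_factor' p r) (at r)"
  unfolding defect_factor_def[abs_def] defect_factor'_def by (auto intro!: derivative_eq_intros simp: algebra_simps)

lemma defect_factor'_deriv:
  assumes "r < 1"
  shows "(defect_factor' p has_real_derivative defect_factor'' p r) (at r)"
proof -
  have "p - 2 + (1 - 2 * p) = - p - 1" by simp
  then have "(1 - r) powr (p - 2) * (1 - r) powr (1 - 2 * p) = (1 - r) powr (- p - 1)"
    by (simp only: powr_add[symmetric])
  then have "defect_factor'' p r = p * (1 - p) * (b * (1 - r) powr (p - 2) - (c - b) * (1 - r) powr (- p - 1))"
    by (simp add: defect_factor''_def algebra_simps)
  moreover have "(defect_factor' p has_real_derivative
      p * (1 - p) * (b * (1 - r) powr (p - 2) - (c - b) * (1 - r) powr (- p - 1))) (at r)"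
    unfolding defect_factor'_def[abs_def] using assms
    by (auto intro!: derivative_eq_intros simp: algebra_simps)
  ultimately show ?thesis by simp
qed

lemma defect_factor_tendsto_0: "((\<lambda>r. s * defect_factor p r) \<longlongrightarrow> 0) (at_right 0)"
proof -
  have "defect_factor p 0 = 0" by (simp add: defect_factor_def)
  then have "(defect_factor p \<longlongrightarrow> 0) (at_right 0)"
    using isCont_imp_tendsto_at_right[OF DERIV_isCont[OF defect_factor_deriv[of 0 p]]] by simp
  then show ?thesis using tendsto_mult_right_zero by blast
qed

lemma defect_factor'_tendsto_0: "((\<lambda>r. s * defect_factor' p r) \<longlongrightarrow> s * (p * (1 + c) - (a + c))) (at_right 0)"
proof -
  have "defect_factor' p 0 = p * (1 + c) - (a + c)" by (simp add: defect_factor'_def algebra_simps)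
  then have "(defect_factor' p \<longlongrightarrow> p * (1 + c) - (a + c)) (at_right 0)"
    using isCont_imp_tendsto_at_right[OF DERIV_isCont[OF defect_factor'_deriv[of 0 p]]] by simp
  then show ?thesis by (intro tendsto_mult tendsto_const)
qed

lemma sgn_defect_factor_deriv: "r < 1 \<Longrightarrow> ((\<lambda>r. s * defect_factor p r) has_real_derivative s * defect_factor' p r) (at r)"
  by (intro DERIV_cmult defect_factor_deriv)

lemma sgn_defect_factor'_deriv: "r < 1 \<Longrightarrow> ((\<lambda>r. s * defect_factor' p r) has_real_derivative s * defect_factor'' p r) (at r)"
  by (intro DERIV_cmult defect_factor'_deriv)

text \<open>At \<open>p = p_zero\<close> value and slope at 0 both vanish, so the second derivative
  decides.\<close>

lemma defect_factor_sgn: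
  assumes "p * (1 + c) = a + c" and k'': "\<And>r. 0 < r \<Longrightarrow> r < 1 \<Longrightarrow> s * defect_factor'' p r < 0"
    and r: "0 < r" "r < 1"
  shows "s * defect_factor p r < 0"
proof -
  have "((\<lambda>r. s * defect_factor' p r) \<longlongrightarrow> 0) (at_right 0)"
    using defect_factor'_tendsto_0[of s p] assms(1) by simp
  then have "s * defect_factor' p r < 0" if "0 < r" "r < 1" for r
    using neg_of_deriv_neg[OF _ sgn_defect_factor'_deriv k'' that] by auto
  then show ?thesis
    using neg_of_deriv_neg[OF defect_factor_tendsto_0 sgn_defect_factor_deriv _ r] by auto
qed

lemma defect_factor'_eventually_sgn:
  assumes "0 < s * (p * (1 + c) - (a + c))"
  shows "\<forall>\<^sub>F r in at_right 0. - s * defect_factor' p r < 0"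
  using order_tendstoD(1)[OF defect_factor'_tendsto_0 assms] by (auto elim: eventually_mono)

lemma defect_factor_eventually_sgn:
  assumes "0 < s * (p * (1 + c) - (a + c))"
  shows "\<forall>\<^sub>F r in at_right 0. 0 < s * defect_factor p r"
  using eventually_neg_of_deriv_neg[OF defect_factor_tendsto_0 sgn_defect_factor_deriv defect_factor'_eventually_sgn[OF assms]]
  by (auto elim: eventually_mono)

text \<open>The derivative of \<open>- (s * defect_factor p r)\<close> starts negative and
  increases, so it has the pattern; integration from 0 transfers it.\<close>

lemma defect_factor_neg_then_pos:
  assumes pos: "0 < s * (p * (1 + c) - (a + c))" and k'': "\<And>r. 0 < r \<Longrightarrow> r < 1 \<Longrightarrow> s * defect_factor'' p r < 0"
  shows "neg_then_pos (\<lambda>r. - (s * defect_factor p r))"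
proof -
  have "- s * defect_factor' p q < - s * defect_factor' p t" if "0 < q" "q < t" "t < 1" for q t
  proof (rule DERIV_pos_imp_increasing[OF that(2)])
    fix x assume "q \<le> x" "x \<le> t"
    then show "\<exists>y. ((\<lambda>r. - s * defect_factor' p r) has_real_derivative y) (at x) \<and> 0 < y"
      using that sgn_defect_factor'_deriv[of x "- s" p] k''[of x] by (intro exI[of _ "- s * defect_factor'' p x"]) auto
  qed
  then have "neg_then_pos (\<lambda>r. - s * defect_factor' p r)"
    unfolding neg_then_pos_def using defect_factor'_eventually_sgn[OF pos] by force
  then have "neg_then_pos (\<lambda>r. - s * defect_factor p r)"
    by (rule neg_then_pos_of_deriv[OF defect_factor_tendsto_0 sgn_defect_factor_deriv, rotated -1])
  then show ?thesis by simp
qed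

lemma defect_factor''_neg:
  assumes "2 * b \<le> c" "1 / 2 \<le> p" "p < 1" "2 * b < c \<or> 1 / 2 < p" and r: "0 < r" "r < 1"
  shows "defect_factor'' p r < 0"
proof -
  let ?y = "(1 - r) powr (1 - 2 * p)"
  have ge: "1 \<le> ?y" using r assms(2) powr_mono'[of "1 - 2 * p" 0 "1 - r"] by auto
  have "b < (c - b) * ?y"
  proof (cases "2 * b < c")
    case True
    have "(c - b) * 1 \<le> (c - b) * ?y" using ge b_less by (intro mult_left_mono) auto
    then show ?thesis using True by simp
  next
    case False
    then have "1 < ?y" using assms r powr_less_mono'[of "1 - r" "1 - 2 * p" 0] by auto
    then have "(c - b) * 1 < (c - b) * ?y" using b_less by (intro mult_strict_left_mono) auto
    then show ?thesis using assms(1) by simp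
  qed
  then show ?thesis
    unfolding defect_factor''_def using assms by (intro mult_pos_neg) auto
qed

lemma defect_factor''_pos:
  assumes "c \<le> 2 * b" "0 < p" "p \<le> 1 / 2" "c < 2 * b \<or> p < 1 / 2" and r: "0 < r" "r < 1"
  shows "0 < defect_factor'' p r"
proof -
  let ?y = "(1 - r) powr (1 - 2 * p)"
  have le: "?y \<le> 1" using r assms(3) by (intro powr_le1) auto
  have "(c - b) * ?y < b"
  proof (cases "c < 2 * b")
    case True
    have "(c - b) * ?y \<le> (c - b) * 1" using le b_less by (intro mult_left_mono) auto
    then show ?thesis using True by simp
  next
    case False
    then have "?y < 1" using assms r powr_less_mono'[of "1 - r" 0 "1 - 2 * p"] by auto
    then have "(c - b) * ?y < (c - b) * 1" using b_less by (intro mult_strict_left_mono) auto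
    then show ?thesis using assms(1) by simp
  qed
  then show ?thesis
    unfolding defect_factor''_def using assms by (intro mult_pos_pos) auto
qed

section \<open>The two critical exponents and their necessity\<close>

abbreviation p0 :: real where "p0 \<equiv> p_zero a c"
abbreviation pE :: real where "pE \<equiv> p_end a b c"

lemma ln_w_neg: "ln w < 0"
  using w_bounds by simp

lemma p0_pos: "0 < p0"
  using b_pos c_gt c_pos by (simp add: p_zero_def)

lemma less_p0_iff: "p < p0 \<longleftrightarrow> p * (1 + c) < a + c" and p0_less_iff: "p0 < p \<longleftrightarrow> a + c < p * (1 + c)"
  and p0_eq: "p0 * (1 + c) = a + c"
  using c_pos by (auto simp: p_zero_def field_simps)

lemma defect_factor_1: "r < 1 \<Longrightarrow> defect_factor 1 r = (1 - a) * r"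
  by (simp add: defect_factor_def algebra_simps)

text \<open>Comparison with the arithmetic mean: at p = 1 the defect is \<open>(1 - a) * r\<close>.
  This gives \<open>pE \<le> 1\<close> and the negative sign of the denominator of
  \<open>pE\<close>.\<close>

lemma log_hyp_at_1_le: "log_hyp_at_1 \<le> ln w" and log_hyp_at_1_less: "a < 1 \<Longrightarrow> log_hyp_at_1 < ln w"
proof -
  show less: "log_hyp_at_1 < ln w" if "a < 1"
    using diff_sgn(2)[of 1 1] that by (simp add: defect_factor_1)
  show "log_hyp_at_1 \<le> ln w"
  proof (cases "a < 1")
    case False
    then have "defect_factor 1 r = 0" if "r < 1" for r using a_le defect_factor_1[OF that] by simp
    then show ?thesis using diff_zero(2)[of 1] by simp
  qed (use less in simp)
qed

lemma log_hyp_at_1_neg: "log_hyp_at_1 < 0"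
  using log_hyp_at_1_le ln_w_neg by simp

lemma pE_pos: "0 < pE" and pE_le_1: "pE \<le> 1" and pE_less_1: "a < 1 \<Longrightarrow> pE < 1"
  using log_hyp_at_1_neg ln_w_neg log_hyp_at_1_le log_hyp_at_1_less unfolding p_end_eq
  by (auto simp: divide_neg_neg neg_divide_le_eq neg_divide_less_eq divide_le_eq_1 divide_less_eq_1)

lemma log_hyp_at_1_eq: "log_hyp_at_1 = ln w / pE"
  using log_hyp_at_1_neg ln_w_neg unfolding p_end_eq by simp

lemma pE_le_iff:
  assumes "0 < p"
  shows "log_hyp_at_1 \<le> ln w / p \<longleftrightarrow> pE \<le> p"
  using log_hyp_at_1_neg assms unfolding p_end_eq by (simp add: pos_le_divide_eq neg_divide_le_eq mult.commute)

lemma le_pE_iff: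
  assumes "0 < p"
  shows "ln w / p \<le> log_hyp_at_1 \<longleftrightarrow> p \<le> pE"
  using log_hyp_at_1_neg assms unfolding p_end_eq by (simp add: pos_divide_le_eq neg_le_divide_eq mult.commute)

text \<open>The bound by \<open>p0\<close> comes from the sign of the difference near r = 0, the
  bound by \<open>pE\<close> from the limit at r = 1.\<close>

lemma diff_nonneg_imp:
  assumes p: "0 < p" and le: "\<And>r. 0 < r \<Longrightarrow> r < 1 \<Longrightarrow> log_power p r \<le> log_hyp r"
  shows "p \<le> p0" "p \<le> pE"
proof -
  have ev: "\<forall>\<^sub>F r in at_right 0. (0::real) < r \<and> r < 1"
    unfolding eventually_at_right_field by (intro exI[of _ 1]) auto
  show "p \<le> p0"
  proof (rule ccontr)
    assume "\<not> p \<le> p0"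
    then have "\<forall>\<^sub>F r in at_right 0. 0 < 1 * defect_factor p r"
      using p0_less_iff[of p] by (intro defect_factor_eventually_sgn) auto
    from diff_eventually_sgn[OF p this] ev have "\<forall>\<^sub>F r in at_right (0::real). False"
      by eventually_elim (use le in force)
    then show False by simp
  qed
  have "\<forall>\<^sub>F r in at_left 1. 0 \<le> log_hyp r - log_power p r"
    unfolding eventually_at_left_field using le by (intro exI[of _ 0]) auto
  then have "0 \<le> log_hyp_at_1 - ln w / p"
    by (intro tendsto_lowerbound[OF diff_tendsto_1[OF p]]) auto
  then show "p \<le> pE" using le_pE_iff[OF p] by simp
qed

lemma diff_nonpos_imp:
  assumes p: "0 < p" and le: "\<And>r. 0 < r \<Longrightarrow> r < 1 \<Longrightarrow> log_hyp r \<le> log_power p r"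
  shows "p0 \<le> p" "pE \<le> p"
proof -
  have ev: "\<forall>\<^sub>F r in at_right 0. (0::real) < r \<and> r < 1"
    unfolding eventually_at_right_field by (intro exI[of _ 1]) auto
  show "p0 \<le> p"
  proof (rule ccontr)
    assume "\<not> p0 \<le> p"
    then have "\<forall>\<^sub>F r in at_right 0. 0 < -1 * defect_factor p r"
      using less_p0_iff[of p] by (intro defect_factor_eventually_sgn) auto
    from diff_eventually_sgn[OF p this] ev have "\<forall>\<^sub>F r in at_right (0::real). False"
      by eventually_elim (use le in force)
    then show False by simp
  qed
  have "\<forall>\<^sub>F r in at_left 1. log_hyp r - log_power p r \<le> 0"
    unfolding eventually_at_left_field using le by (intro exI[of _ 0]) auto
  then have "log_hyp_at_1 - ln w / p \<le> 0"
    by (intro tendsto_upperbound[OF diff_tendsto_1[OF p]]) auto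
  then show "pE \<le> p" using pE_le_iff[OF p] by simp
qed

section \<open>From logarithms back to the means\<close>

abbreviation H :: "real \<Rightarrow> real" where "H \<equiv> hyp_mean a b c"
abbreviation A :: "real \<Rightarrow> real \<Rightarrow> real" where "A p r \<equiv> power_mean p w (1 - r)"

lemma lower_bound_imp:
  assumes "\<forall>r\<in>{0<..<1}. A l r \<le> H r"
  shows "l \<le> p0" "l \<le> pE"
proof -
  have "l \<le> p0 \<and> l \<le> pE" if "0 < l"
    using diff_nonneg_imp[OF that] assms that by (auto simp: power_mean_eq hyp_mean_eq)
  then show "l \<le> p0" "l \<le> pE" using p0_pos pE_pos by fastforce+
qed

lemma upper_bound_imp:
  assumes "\<forall>r\<in>{0<..<1}. H r \<le> A m r"
  shows "p0 \<le> m" "pE \<le> m"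
proof -
  have *: "p0 \<le> q \<and> pE \<le> q" if "m \<le> q" "0 < q" for q
  proof -
    have "H r \<le> A q r" if "0 < r" "r < 1" for r
    proof (rule order_trans)
      show "H r \<le> A m r" using assms that by simp
      show "A m r \<le> A q r"
        by (rule power_mean_mono) (use w_bounds that \<open>m \<le> q\<close> \<open>0 < q\<close> in auto)
    qed
    then show ?thesis
      using diff_nonpos_imp[OF \<open>0 < q\<close>] \<open>0 < q\<close> by (auto simp: power_mean_eq hyp_mean_eq)
  qed
  \<comment> \<open>For \<open>m \<le> 0\<close> the upper bound would also hold with exponent
    \<open>p0 / 2\<close>, forcing \<open>p0 \<le> p0 / 2\<close>.\<close>
  have "0 < m"
    using *[of "p0 / 2"] p0_pos by (cases "0 < m") auto
  then show "p0 \<le> m" "pE \<le> m" using *[of m] by auto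
qed

text \<open>Necessity compares each exponent with both \<open>p0\<close> and \<open>pE\<close>, so
  one statement covers either order of the two; sufficiency is monotonicity in the exponent.\<close>

lemma bounds_iff:
  assumes bounds: "\<forall>r\<in>{0<..<1}. A lo r \<le> H r \<and> H r \<le> A hi r"
    and lo_hi: "{lo, hi} = {p0, pE}"
  shows "(\<forall>r\<in>{0<..<1}. A l r \<le> H r \<and> H r \<le> A m r) \<longleftrightarrow> l \<le> lo \<and> hi \<le> m"
proof
  assume "\<forall>r\<in>{0<..<1}. A l r \<le> H r \<and> H r \<le> A m r"
  then show "l \<le> lo \<and> hi \<le> m"
    using lower_bound_imp[of l] upper_bound_imp[of m] lo_hi by (auto simp: doubleton_eq_iff)
next
  assume lm: "l \<le> lo \<and> hi \<le> m"
  have pos: "0 < lo" "0 < hi" using lo_hi p0_pos pE_pos by (auto simp: doubleton_eq_iff)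
  have "A l r \<le> A lo r \<and> A hi r \<le> A m r" if "0 < r" "r < 1" for r
    using lm pos that w_bounds by (auto intro!: power_mean_mono)
  then show "\<forall>r\<in>{0<..<1}. A l r \<le> H r \<and> H r \<le> A m r"
    using bounds by (meson greaterThanLessThan_iff order_trans)
qed

text \<open>Here \<open>1/2 \<le> p0\<close>, so the defect factor is concave for p in [p0, 1). At
  \<open>p0\<close> it is negative, which gives the lower bound and \<open>p0 < pE\<close>; at
  \<open>pE\<close> it has positive slope at 0, and the crossing argument gives the upper
  bound.\<close>

lemma bounds_case1:
  assumes c: "1 - 2 * a \<le> c" "2 * b \<le> c" and a: "a < 1" and ne: "\<not> (c = 2 * b \<and> 2 * b = 1 - 2 * a)"
  shows "p0 < pE" and "\<And>r. 0 < r \<Longrightarrow> r < 1 \<Longrightarrow> A p0 r < H r \<and> H r < A pE r"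
proof -
  have p0: "1 / 2 \<le> p0" "p0 < 1"
    using less_p0_iff[of "1/2"] p0_less_iff[of "1/2"] p0_less_iff[of 1] c a by auto
  have strict: "2 * b < c \<or> 1 / 2 < p0"
    using less_p0_iff[of "1/2"] ne c by auto
  have k: "0 < -1 * defect_factor p0 r" if "0 < r" "r < 1" for r
    using defect_factor_sgn[of p0 1 r] defect_factor''_neg[of p0] p0_eq that c p0 strict by auto
  have low: "log_power p0 r < log_hyp r" if "0 < r" "r < 1" for r
    using diff_sgn(1)[OF p0_pos k that] by simp
  have "\<not> log_hyp_at_1 \<le> ln w / p0"
    using diff_sgn(2)[OF p0_pos k] by simp
  then show less: "p0 < pE" using pE_le_iff[OF p0_pos] by simp
  have "neg_then_pos (\<lambda>r. - (1 * defect_factor pE r))"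
    using p0_less_iff[of pE] less p0 pE_less_1[OF a] c
    by (intro defect_factor_neg_then_pos) (auto intro!: defect_factor''_neg)
  from diff_sgn_crossing[OF pE_pos this log_hyp_at_1_eq]
  have up: "log_hyp r < log_power pE r" if "0 < r" "r < 1" for r using that by simp
  show "A p0 r < H r \<and> H r < A pE r" if "0 < r" "r < 1" for r
    using low[OF that] up[OF that] that p0_pos pE_pos by (simp add: power_mean_eq hyp_mean_eq)
qed

text \<open>The mirror image: \<open>p0 \<le> 1/2\<close> makes the defect factor convex for p in
  (0, p0], and all signs are reversed.\<close>

lemma bounds_case2:
  assumes c: "c \<le> 1 - 2 * a" "c \<le> 2 * b" and ne: "\<not> (c = 2 * b \<and> 2 * b = 1 - 2 * a)"
  shows "pE < p0" and "\<And>r. 0 < r \<Longrightarrow> r < 1 \<Longrightarrow> A pE r < H r \<and> H r < A p0 r"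
proof -
  have p0: "p0 \<le> 1 / 2"
    using less_p0_iff[of "1/2"] c by auto
  have strict: "c < 2 * b \<or> p0 < 1 / 2"
    using p0_less_iff[of "1/2"] ne c by auto
  have k: "0 < 1 * defect_factor p0 r" if "0 < r" "r < 1" for r
    using defect_factor_sgn[of p0 "-1" r] defect_factor''_pos[of p0] p0_eq p0_pos that c p0 strict by auto
  have up: "log_hyp r < log_power p0 r" if "0 < r" "r < 1" for r
    using diff_sgn(1)[OF p0_pos k that] by simp
  have "\<not> ln w / p0 \<le> log_hyp_at_1"
    using diff_sgn(2)[OF p0_pos k] by simp
  then show less: "pE < p0" using le_pE_iff[OF p0_pos] by simp
  have "neg_then_pos (\<lambda>r. - (-1 * defect_factor pE r))"
    using less_p0_iff[of pE] less p0 pE_pos c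
    by (intro defect_factor_neg_then_pos) (auto intro!: defect_factor''_pos)
  from diff_sgn_crossing[OF pE_pos this log_hyp_at_1_eq]
  have low: "log_power pE r < log_hyp r" if "0 < r" "r < 1" for r using that by simp
  show "A pE r < H r \<and> H r < A p0 r" if "0 < r" "r < 1" for r
    using low[OF that] up[OF that] that p0_pos pE_pos by (simp add: power_mean_eq hyp_mean_eq)
qed

text \<open>With identical means \<open>p\<close> is admissible as lower and as upper exponent, so
  the necessary conditions pin down both critical exponents.\<close>

lemma equality_case:
  assumes "\<And>r. 0 < r \<Longrightarrow> r < 1 \<Longrightarrow> defect_factor p r = 0" and p: "0 < p"
  shows "p0 = p" "pE = p" "\<And>r. 0 < r \<Longrightarrow> r < 1 \<Longrightarrow> H r = A p r"
proof -
  have eq: "log_hyp r = log_power p r" if "0 < r" "r < 1" for r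
    using diff_zero(1)[OF p, of r] assms(1) that by blast
  then show "H r = A p r" if "0 < r" "r < 1" for r
    using that p by (simp add: power_mean_eq hyp_mean_eq)
  show "p0 = p" "pE = p"
    using diff_nonneg_imp[OF p] diff_nonpos_imp[OF p] eq by (auto intro!: antisym)
qed

text \<open>At p = 1/2 the two powers coincide and their coefficients cancel; the remaining
  coefficients are zero.\<close>

lemma defect_factor_half:
  assumes "c = 2 * b" "2 * b = 1 - 2 * a" "r < 1"
  shows "defect_factor (1 / 2) r = 0"
proof -
  have eqs: "c - b = b" "c + a - b - 1 / 2 = 0" "a + b - 1 / 2 = 0"
    using assms by auto
  show ?thesis unfolding defect_factor_def eqs by simp
qed

end

theorem theorem1p1:
  fixes a b c :: real
  assumes "a \<le> 1" and "b > 0" and "c > b" and "c > b - a"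
  shows
    "(c \<ge> max (1 - 2 * a) (2 * b) \<longrightarrow>
        0 < p_zero a c \<and> p_zero a c \<le> p_end a b c \<and> p_end a b c \<le> 1 \<and>
        (\<forall>l m :: real.
           (\<forall>r\<in>{0<..<1}. power_mean l (mean_weight b c) (1 - r) \<le> hyp_mean a b c r \<and>
                           hyp_mean a b c r \<le> power_mean m (mean_weight b c) (1 - r))
           \<longleftrightarrow> l \<le> p_zero a c \<and> m \<ge> p_end a b c) \<and>
        (a = 1 \<longrightarrow>
           p_zero a c = 1 \<and> p_end a b c = 1 \<and>
           (\<forall>r\<in>{0<..<1}. hyp_mean a b c r = power_mean 1 (mean_weight b c) (1 - r))) \<and>
        (c = 2 * b \<and> 2 * b = 1 - 2 * a \<longrightarrow>
           p_zero a c = 1 / 2 \<and> p_end a b c = 1 / 2 \<and>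
           (\<forall>r\<in>{0<..<1}. hyp_mean a b c r = power_mean (1 / 2) (mean_weight b c) (1 - r))) \<and>
        (\<not> a = 1 \<and> \<not> (c = 2 * b \<and> 2 * b = 1 - 2 * a) \<longrightarrow>
           p_zero a c < p_end a b c \<and> p_end a b c < 1 \<and>
           (\<forall>r\<in>{0<..<1}.
              power_mean (p_zero a c) (mean_weight b c) (1 - r) < hyp_mean a b c r \<and>
              hyp_mean a b c r < power_mean (p_end a b c) (mean_weight b c) (1 - r))))
     \<and>
     (c \<le> min (1 - 2 * a) (2 * b) \<longrightarrow>
        0 < p_end a b c \<and> p_end a b c \<le> p_zero a c \<and> p_zero a c < 1 \<and>
        (\<forall>l m :: real.
           (\<forall>r\<in>{0<..<1}. power_mean l (mean_weight b c) (1 - r) \<le> hyp_mean a b c r \<and>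
                           hyp_mean a b c r \<le> power_mean m (mean_weight b c) (1 - r))
           \<longleftrightarrow> l \<le> p_end a b c \<and> m \<ge> p_zero a c) \<and>
        (p_end a b c = p_zero a c \<longleftrightarrow> c = 2 * b \<and> 2 * b = 1 - 2 * a) \<and>
        (c = 2 * b \<and> 2 * b = 1 - 2 * a \<longrightarrow>
           p_zero a c = 1 / 2 \<and> p_end a b c = 1 / 2 \<and>
           (\<forall>r\<in>{0<..<1}. hyp_mean a b c r = power_mean (1 / 2) (mean_weight b c) (1 - r))) \<and>
        (\<not> (c = 2 * b \<and> 2 * b = 1 - 2 * a) \<longrightarrow>
           (\<forall>r\<in>{0<..<1}.
              power_mean (p_end a b c) (mean_weight b c) (1 - r) < hyp_mean a b c r \<and>
              hyp_mean a b c r < power_mean (p_zero a c) (mean_weight b c) (1 - r))))"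
proof -
  interpret hyp_mean_params a b c
    using assms by unfold_locales auto
  let ?R = "{0<..<1} :: real set"
  have half: "p0 = 1 / 2" "pE = 1 / 2" "\<forall>r\<in>?R. H r = A (1 / 2) r"
    if "c = 2 * b \<and> 2 * b = 1 - 2 * a"
    using equality_case[of "1 / 2"] defect_factor_half that by auto
  have one: "p0 = 1" "pE = 1" "\<forall>r\<in>?R. H r = A 1 r" if "a = 1"
    using equality_case[of 1] defect_factor_1 that by auto
  have strict1: "p0 < pE \<and> pE < 1 \<and> (\<forall>r\<in>?R. A p0 r < H r \<and> H r < A pE r)"
    if "max (1 - 2 * a) (2 * b) \<le> c" "\<not> a = 1 \<and> \<not> (c = 2 * b \<and> 2 * b = 1 - 2 * a)"
    using bounds_case1 pE_less_1 that assms(1) by auto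
  have strict2: "pE < p0 \<and> (\<forall>r\<in>?R. A pE r < H r \<and> H r < A p0 r)"
    if "c \<le> min (1 - 2 * a) (2 * b)" "\<not> (c = 2 * b \<and> 2 * b = 1 - 2 * a)"
    using bounds_case2 that by auto
  have equal: "p0 = pE \<and> (\<forall>r\<in>?R. H r = A p0 r)"
    if "a = 1 \<or> (c = 2 * b \<and> 2 * b = 1 - 2 * a)"
    using that
  proof
    assume "a = 1"
    show ?thesis unfolding one(1,2)[OF \<open>a = 1\<close>] using one(3)[OF \<open>a = 1\<close>] by simp
  next
    assume eq: "c = 2 * b \<and> 2 * b = 1 - 2 * a"
    show ?thesis unfolding half(1,2)[OF eq] using half(3)[OF eq] by simp
  qed
  have case1: "p0 \<le> pE \<and> (\<forall>r\<in>?R. A p0 r \<le> H r \<and> H r \<le> A pE r)"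
    if "max (1 - 2 * a) (2 * b) \<le> c"
    using strict1[OF that] equal by (metis order_le_less)
  have case2: "pE \<le> p0 \<and> (\<forall>r\<in>?R. A pE r \<le> H r \<and> H r \<le> A p0 r)"
    if "c \<le> min (1 - 2 * a) (2 * b)"
    using strict2[OF that] equal by (metis order_le_less)
  have p0_less_1: "p0 < 1" if "c \<le> min (1 - 2 * a) (2 * b)"
    using p0_less_iff[of 1] c_pos that by auto
  have iff1: "(\<forall>r\<in>?R. A l r \<le> H r \<and> H r \<le> A m r) \<longleftrightarrow> l \<le> p0 \<and> m \<ge> pE"
    if "max (1 - 2 * a) (2 * b) \<le> c" for l m
    by (rule bounds_iff[OF conjunct2[OF case1[OF that]]]) simp
  have iff2: "(\<forall>r\<in>?R. A l r \<le> H r \<and> H r \<le> A m r) \<longleftrightarrow> l \<le> pE \<and> m \<ge> p0"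
    if "c \<le> min (1 - 2 * a) (2 * b)" for l m
    by (rule bounds_iff[OF conjunct2[OF case2[OF that]]]) auto
  have eq_iff: "pE = p0 \<longleftrightarrow> c = 2 * b \<and> 2 * b = 1 - 2 * a" if "c \<le> min (1 - 2 * a) (2 * b)"
    using strict2[OF that] half by fastforce
  note facts = p0_pos pE_pos pE_le_1 p0_less_1 iff1 iff2 eq_iff half one
    conjunct1[OF case1] conjunct1[OF case2] strict2[THEN conjunct2]
    strict1[THEN conjunct1] strict1[THEN conjunct2, THEN conjunct1] strict1[THEN conjunct2, THEN conjunct2]
  show ?thesis
    by (intro conjI impI allI; rule facts; assumption)
qed

end
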